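(* Let $(M,\rho)$ be a metric space, $f:[a,b]\to M$ of bounded variation, and $A\subset[a,b]$ Lebesgue measurable. Then $$m^*(v_f(A))\ge\int_A md(f,x)\,dx,$$ where $m^*$ is Lebesgue outer measure. Equality holds if $f$ is absolutely continuous.
   Context: $v_f(x)=\bigvee_a^x f=\sup\sum_i\rho(f(x_i),f(x_{i+1}))$ over partitions $a=x_0<\dots<x_n=x$ of $[a,x]$; bounded variation means $v_f(b)<\infty$. $md(f,x)=\lim_{t\to0,\ x+t\in[a,b]}\rho(f(x+t),f(x))/|t|$ when it exists. Absolute continuity of $f$: for every $\varepsilon>0$ there is $\delta>0$ such that for non-overlapping intervals $[a_i,b_i]\subset[a,b]$ with $\sum_i(b_i-a_i)<\delta$ one has $\sum_i\rho(f(b_i),f(a_i))<\varepsilon$. *)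

theory Defs
  imports "HOL-Analysis.Analysis"
begin

definition variation :: "(real \<Rightarrow> 'a::metric_space) \<Rightarrow> real \<Rightarrow> real \<Rightarrow> ennreal" where
  "variation f a x = (SUP np \<in> {(n, p). p 0 = a \<and> p n = x \<and> (\<forall>i<n. p i < p (Suc i))}.
      ennreal (\<Sum>i<fst np. dist (f (snd np (Suc i))) (f (snd np i))))"

definition bounded_variation :: "(real \<Rightarrow> 'a::metric_space) \<Rightarrow> real \<Rightarrow> real \<Rightarrow> bool" where
  "bounded_variation f a b \<longleftrightarrow> variation f a b < \<infinity>"

definition var_fun :: "(real \<Rightarrow> 'a::metric_space) \<Rightarrow> real \<Rightarrow> real \<Rightarrow> real" where
  "var_fun f a x = enn2real (variation f a x)"

definition md_exists :: "(real \<Rightarrow> 'a::metric_space) \<Rightarrow> real \<Rightarrow> real \<Rightarrow> real \<Rightarrow> bool" where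
  "md_exists f a b x \<longleftrightarrow> (\<exists>l. ((\<lambda>y. dist (f y) (f x) / \<bar>y - x\<bar>) \<longlongrightarrow> l) (at x within {a..b}))"

definition md :: "(real \<Rightarrow> 'a::metric_space) \<Rightarrow> real \<Rightarrow> real \<Rightarrow> real \<Rightarrow> real" where
  "md f a b x = Lim (at x within {a..b}) (\<lambda>y. dist (f y) (f x) / \<bar>y - x\<bar>)"

definition absolutely_continuous_on_interval :: "(real \<Rightarrow> 'a::metric_space) \<Rightarrow> real \<Rightarrow> real \<Rightarrow> bool" where
  "absolutely_continuous_on_interval f a b \<longleftrightarrow>
     (\<forall>\<epsilon>>0. \<exists>\<delta>>0. \<forall>(n::nat) (u::nat \<Rightarrow> real) (v::nat \<Rightarrow> real).
        (\<forall>i<n. a \<le> u i \<and> u i \<le> v i \<and> v i \<le> b) \<longrightarrow>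
        (\<forall>i<n. \<forall>j<n. i \<noteq> j \<longrightarrow> v i \<le> u j \<or> v j \<le> u i) \<longrightarrow>
        (\<Sum>i<n. v i - u i) < \<delta> \<longrightarrow>
        (\<Sum>i<n. dist (f (v i)) (f (u i))) < \<epsilon>)"

definition lebesgue_outer :: "real set \<Rightarrow> ennreal" where
  "lebesgue_outer S = (INF T \<in> {T \<in> sets lebesgue. S \<subseteq> T}. emeasure lebesgue T)"

end

(* Write v for the variation function. It is monotone and dominates the increments of f, and its
   derivative h exists almost everywhere and equals md f there: subtracting from v the distances to
   the values of f at the points of a nearly optimal partition leaves, on each cell, a monotone
   function, and the total increment of these functions is small, so by a Vitali covering argument
   they have small slope off a set of small measure. On the part of A where h > 0 the function v is
   injective and the change of variables formula gives the image the measure "integral of h". The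
   remaining points contribute nothing to the integral, which proves the inequality. If f is
   absolutely continuous, v maps null sets to null sets, hence also the set where h = 0 (cover it
   by intervals of small slope, up to a null set), and equality follows. *)
theory Submission
  imports Defs
begin

text \<open>Subtracting \<open>dist (f x) z\<close> from the variation keeps it increasing, because
  an increment of the variation dominates the change of that distance. The device serves twice: it
  compares the slope of the variation with the metric slope of f, and under absolute continuity it
  splits increments of the variation into a part bounded by the defect of a fixed partition and a
  part bounded through f itself, which gives the null set property directly. The exceptional sets
  are not known to be measurable. Hence the covering estimates deliver a measurable superset with a
  bound on its measure, and null sets are recognised by outer approximation. Slopes are quotients of
  absolute values, so that they have the shape of the metric derivative and treat both sides of a
  point at once. The variation may jump, so the image of an interval is only enclosed between the
  end values; for covering purposes this is enough.\<close>

section \<open>Coverings by intervals\<close>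

text \<open>Pairs of endpoints instead of sets, since increments of functions over the intervals
  will be summed. Common endpoints are allowed, as for adjacent cells of a subdivision.\<close>

definition nonoverlapping :: "(real \<times> real) set \<Rightarrow> bool" where
  "nonoverlapping C \<longleftrightarrow>
     (\<forall>I\<in>C. fst I < snd I) \<and> pairwise (\<lambda>I J. snd I \<le> fst J \<or> snd J \<le> fst I) C"

lemma nonoverlapping_subset: "nonoverlapping C \<Longrightarrow> D \<subseteq> C \<Longrightarrow> nonoverlapping D"
  unfolding nonoverlapping_def by (meson pairwise_subset subsetD)

text \<open>The open intervals are disjoint, so additivity of the measure applies. Endpoints are
  functions of an index and may coincide, because a monotone function can collapse intervals or send
  several to the same one.\<close>

lemma sum_length_le_measure:
  fixes l r :: "'i \<Rightarrow> real"
  assumes "finite C" and le: "\<And>I. I \<in> C \<Longrightarrow> l I \<le> r I"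
    and sub: "\<And>I. I \<in> C \<Longrightarrow> {l I<..<r I} \<subseteq> U" and U: "U \<in> lmeasurable"
    and disj: "pairwise (\<lambda>I J. r I \<le> l J \<or> r J \<le> l I) C"
  shows "(\<Sum>I\<in>C. r I - l I) \<le> measure lebesgue U"
proof -
  have dj: "disjoint_family_on (\<lambda>I. {l I<..<r I}) C"
    using disj unfolding disjoint_family_on_def pairwise_def by fastforce
  have "(\<Sum>I\<in>C. r I - l I) = (\<Sum>I\<in>C. measure lebesgue {l I<..<r I})"
    using le by (intro sum.cong) auto
  also have "\<dots> = measure lebesgue (\<Union>I\<in>C. {l I<..<r I})"
    by (rule measure_finite_Union[symmetric]) (use assms dj in \<open>auto simp: emeasure_lborel_Ioo\<close>)
  also have "\<dots> \<le> measure lebesgue U"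
    by (rule measure_mono_fmeasurable) (use sub U assms(1) in auto)
  finally show ?thesis .
qed

lemma nonoverlapping_sum_length_le:
  assumes "finite C" "nonoverlapping C" "\<And>I. I \<in> C \<Longrightarrow> {fst I..snd I} \<subseteq> U" "U \<in> lmeasurable"
  shows "(\<Sum>I\<in>C. snd I - fst I) \<le> measure lebesgue U"
proof (rule sum_length_le_measure[OF assms(1) _ _ assms(4)])
  show "{fst I<..<snd I} \<subseteq> U" if "I \<in> C" for I
    using assms(3)[OF that] by (meson greaterThanLessThan_subseteq_atLeastAtMost_iff order_refl subset_trans)
qed (use assms(2) in \<open>auto simp: nonoverlapping_def\<close>)

text \<open>Monotonicity carries nonoverlapping intervals to nonoverlapping, possibly degenerate
  intervals between \<open>g c\<close> and \<open>g d\<close>; their lengths are the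
  increments.\<close>

lemma nonoverlapping_sum_increments_le:
  fixes g :: "real \<Rightarrow> real"
  assumes "finite C" "nonoverlapping C" and sub: "\<And>I. I \<in> C \<Longrightarrow> {fst I..snd I} \<subseteq> {c..d}"
    and g: "mono_on {c..d} g" and "c \<le> d"
  shows "(\<Sum>I\<in>C. g (snd I) - g (fst I)) \<le> g d - g c"
proof -
  have I: "c \<le> fst I \<and> fst I < snd I \<and> snd I \<le> d" if "I \<in> C" for I
    using sub[OF that] assms(2) that by (auto simp: nonoverlapping_def)
  have gm: "g x \<le> g y" if "c \<le> x" "x \<le> y" "y \<le> d" for x y
    using g that by (auto simp: mono_on_def)
  have "(\<Sum>I\<in>C. g (snd I) - g (fst I)) \<le> measure lebesgue {g c..g d}"
  proof (rule sum_length_le_measure[OF assms(1)])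
    show "g (fst I) \<le> g (snd I)" if "I \<in> C" for I
      using I[OF that] by (intro gm) auto
    show "{g (fst I)<..<g (snd I)} \<subseteq> {g c..g d}" if "I \<in> C" for I
    proof -
      have "g c \<le> g (fst I)" "g (snd I) \<le> g d"
        using I[OF that] by (auto intro!: gm)
      then show ?thesis by auto
    qed
    have "g (snd J) \<le> g (fst K)" if "J \<in> C" "K \<in> C" "snd J \<le> fst K" for J K
      using I[OF that(1)] I[OF that(2)] that(3) by (intro gm) auto
    then show "pairwise (\<lambda>I J. g (snd I) \<le> g (fst J) \<or> g (snd J) \<le> g (fst I)) C"
      using assms(2) unfolding nonoverlapping_def pairwise_def by blast
  qed auto
  also have "\<dots> = g d - g c"
    using gm[of c d] \<open>c \<le> d\<close> by simp
  finally show ?thesis .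
qed

text \<open>Sums of lengths are only ever estimated over finite subfamilies; a uniform bound on
  these passes to the countable union.\<close>

lemma UN_lmeasurable_sum_bound:
  assumes "countable C" and T: "\<And>I. I \<in> C \<Longrightarrow> T I \<in> lmeasurable"
    and B: "\<And>D. D \<subseteq> C \<Longrightarrow> finite D \<Longrightarrow> (\<Sum>I\<in>D. measure lebesgue (T I)) \<le> B"
  shows "(\<Union>I\<in>C. T I) \<in> lmeasurable" "measure lebesgue (\<Union>I\<in>C. T I) \<le> B"
proof -
  have *: "measure lebesgue (\<Union>I\<in>D. T I) \<le> B" if "D \<subseteq> C" "finite D" for D
  proof -
    have "measure lebesgue (\<Union>I\<in>D. T I) \<le> (\<Sum>I\<in>D. measure lebesgue (T I))"
      by (rule measure_UNION_le) (use that T in blast)+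
    then show ?thesis using B[OF that] by linarith
  qed
  show "(\<Union>I\<in>C. T I) \<in> lmeasurable" "measure lebesgue (\<Union>I\<in>C. T I) \<le> B"
    by (rule fmeasurable_UN_bound[OF assms(1) T *]; assumption)
       (rule measure_UN_bound[OF assms(1) T *]; assumption)
qed

text \<open>An interval is a ball about its midpoint, and Vitali's theorem asks only that x lie in
  the ball. So x may be an endpoint, which is how difference quotients at x produce admissible
  intervals. \<open>R\<close> is the property selecting the intervals, such as a bound on the
  slope.\<close>

lemma Vitali_covering_intervals:
  fixes R :: "real \<Rightarrow> real \<Rightarrow> bool"
  assumes "open U" "S \<subseteq> U"
    and R: "\<And>x e. x \<in> S \<Longrightarrow> 0 < e \<Longrightarrow> \<exists>u w. u < w \<and> u \<le> x \<and> x \<le> w \<and> w - u < e \<and> R u w"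
  obtains C where "countable C" "nonoverlapping C"
    "\<And>I. I \<in> C \<Longrightarrow> {fst I..snd I} \<subseteq> U \<and> R (fst I) (snd I)"
    "negligible (S - (\<Union>I\<in>C. {fst I..snd I}))"
proof -
  define K where "K = {I. fst I < snd I \<and> {fst I..snd I} \<subseteq> U \<and> R (fst I) (snd I)}"
  let ?m = "\<lambda>I::real\<times>real. (fst I + snd I) / 2" and ?r = "\<lambda>I::real\<times>real. (snd I - fst I) / 2"
  have cb: "cball (?m I) (?r I) = {fst I..snd I}" for I
    by (simp add: cball_eq_atLeastAtMost field_simps)
  obtain C where C: "countable C" "C \<subseteq> K"
     "pairwise (\<lambda>i j. disjnt (cball (?m i) (?r i)) (cball (?m j) (?r j))) C"
     "negligible (S - (\<Union>i \<in> C. cball (?m i) (?r i)))"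
  proof (rule Vitali_covering_theorem_cballs[of K ?r S ?m])
    show "0 < ?r i" if "i \<in> K" for i using that by (auto simp: K_def)
    fix x and d :: real assume x: "x \<in> S" "0 < d"
    then obtain e where e: "e > 0" "ball x e \<subseteq> U"
      using assms(1,2) by (meson openE subsetD)
    obtain u w where uw: "u < w" "u \<le> x" "x \<le> w" "w - u < min e d" "R u w"
      using R[of x "min e d"] x e by auto
    have "{u..w} \<subseteq> ball x e" using uw by (auto simp: dist_real_def)
    then have "(u, w) \<in> K" using uw e by (auto simp: K_def)
    moreover have "x \<in> cball (?m (u,w)) (?r (u,w))"
      unfolding cb using uw by simp
    moreover have "?r (u,w) < d" using uw by simp
    ultimately show "\<exists>i. i \<in> K \<and> x \<in> cball (?m i) (?r i) \<and> ?r i < d" by blast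
  qed
  have "nonoverlapping C"
    unfolding nonoverlapping_def
  proof (intro conjI ballI pairwiseI)
    show "fst I < snd I" if "I \<in> C" for I using that C(2) by (auto simp: K_def)
    fix I J assume IJ: "I \<in> C" "J \<in> C" "I \<noteq> J"
    then have d: "disjnt {fst I..snd I} {fst J..snd J}" "fst I < snd I" "fst J < snd J"
      using C(2,3) unfolding cb pairwise_def by (auto simp: K_def)
    \<comment> \<open>Disjoint closed intervals are ordered: otherwise the larger left endpoint
      would belong to both.\<close>
    then have "max (fst I) (fst J) \<notin> {fst I..snd I} \<inter> {fst J..snd J}"
      by (auto simp: disjnt_def)
    with d(2,3) show "snd I \<le> fst J \<or> snd J \<le> fst I" by (auto simp: max_def split: if_splits)
  qed
  with C show thesis by (intro that[of C]) (auto simp: cb K_def)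
qed

text \<open>A weak type estimate: intervals over which \<open>g\<close> grows at rate at least
  \<open>q\<close> cover almost all of \<open>S\<close>, and their total growth is at most
  \<open>g d - g c\<close>. As Vitali's theorem covers up to a null set, no constant is
  lost.\<close>

lemma mono_on_steep_set_bound:
  fixes g :: "real \<Rightarrow> real"
  assumes g: "mono_on {c..d} g" and "c \<le> d" and "0 < q" and S: "S \<subseteq> {c<..<d}"
    and steep: "\<And>x e. x \<in> S \<Longrightarrow> 0 < e \<Longrightarrow> \<exists>y. y \<noteq> x \<and> \<bar>y - x\<bar> < e \<and> q * \<bar>y - x\<bar> \<le> \<bar>g y - g x\<bar>"
  obtains T where "T \<in> lmeasurable" "S \<subseteq> T" "q * measure lebesgue T \<le> g d - g c"
proof -
  let ?R = "\<lambda>u w. c \<le> u \<and> w \<le> d \<and> q * (w - u) \<le> g w - g u"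
  have gm: "g x \<le> g y" if "c \<le> x" "x \<le> y" "y \<le> d" for x y
    using g that by (auto simp: mono_on_def)
  obtain C where C: "countable C" "nonoverlapping C"
    "\<And>I. I \<in> C \<Longrightarrow> {fst I..snd I} \<subseteq> {c<..<d} \<and> ?R (fst I) (snd I)"
    "negligible (S - (\<Union>I\<in>C. {fst I..snd I}))"
  proof (rule Vitali_covering_intervals[of "{c<..<d}" S ?R])
    fix x and e :: real assume x: "x \<in> S" "0 < e"
    \<comment> \<open>The radius is cut down so that y stays in the interval where \<open>g\<close>
      is monotone.\<close>
    define e' where "e' = min e (min (x - c) (d - x))"
    have "e' > 0" using x S by (auto simp: e'_def)
    then obtain y where y: "y \<noteq> x" "\<bar>y - x\<bar> < e'" "q * \<bar>y - x\<bar> \<le> \<bar>g y - g x\<bar>"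
      using steep x by blast
    have y': "\<bar>y - x\<bar> < e" "c \<le> y" "y \<le> d" "c \<le> x" "x \<le> d"
      using y x S by (auto simp: e'_def)
    show "\<exists>u w. u < w \<and> u \<le> x \<and> x \<le> w \<and> w - u < e \<and> ?R u w"
    proof (cases "x < y")
      case True
      have "g x \<le> g y" using True y' by (intro gm) auto
      then show ?thesis using True y y' by (intro exI[of _ x] exI[of _ y]) auto
    next
      case False
      have "g y \<le> g x" using False y' by (intro gm) auto
      then show ?thesis using False y y' by (intro exI[of _ y] exI[of _ x]) auto
    qed
  qed (use S in auto)
  have lt: "fst I < snd I" if "I \<in> C" for I using C(2) that by (auto simp: nonoverlapping_def)
  have "(\<Sum>I\<in>D. measure lebesgue {fst I..snd I}) \<le> (g d - g c) / q" if "D \<subseteq> C" "finite D" for D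
  proof -
    have "q * (\<Sum>I\<in>D. measure lebesgue {fst I..snd I}) = (\<Sum>I\<in>D. q * (snd I - fst I))"
      unfolding sum_distrib_left by (rule sum.cong) (use lt that in \<open>auto simp: less_imp_le\<close>)
    also have "\<dots> \<le> (\<Sum>I\<in>D. g (snd I) - g (fst I))"
      by (rule sum_mono) (use C(3) that in blast)
    also have "\<dots> \<le> g d - g c"
      using that C(3) nonoverlapping_subset[OF C(2)] g \<open>c \<le> d\<close>
      by (intro nonoverlapping_sum_increments_le) fastforce+
    finally show ?thesis using \<open>0 < q\<close> by (simp add: field_simps)
  qed
  note U = UN_lmeasurable_sum_bound[OF C(1) _ this]
  let ?V = "\<Union>I\<in>C. {fst I..snd I}"
  have V: "?V \<in> lmeasurable" "measure lebesgue ?V \<le> (g d - g c) / q"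
    using U by auto
  \<comment> \<open>The part of \<open>S\<close> missed by the covering is null and is added to the
    superset free of charge.\<close>
  have "measure lebesgue (?V \<union> (S - ?V)) = measure lebesgue ?V"
    by (rule measure_negligible_symdiff[OF V(1)]) (auto intro!: negligible_subset[OF C(4)])
  then have "q * measure lebesgue (?V \<union> (S - ?V)) \<le> g d - g c"
    using V(2) \<open>0 < q\<close> by (simp add: field_simps)
  moreover have "?V \<union> (S - ?V) \<in> lmeasurable"
    using V(1) C(4) by (intro fmeasurable.Un) (auto simp: negligible_imp_measurable)
  ultimately show thesis by (intro that[of "?V \<union> (S - ?V)"]) auto
qed

section \<open>Almost everywhere differentiability of monotone functions\<close>

lemma mono_on_infinitely_steep_negligible:
  fixes g :: "real \<Rightarrow> real"
  assumes g: "mono_on {c..d} g" and "c \<le> d" and S: "S \<subseteq> {c<..<d}"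
    and steep: "\<And>x e q. x \<in> S \<Longrightarrow> 0 < e \<Longrightarrow> 0 < q \<Longrightarrow>
      \<exists>y. y \<noteq> x \<and> \<bar>y - x\<bar> < e \<and> q * \<bar>y - x\<bar> \<le> \<bar>g y - g x\<bar>"
  shows "negligible S"
  unfolding negligible_outer_le
proof (intro allI impI)
  fix e :: real assume "e > 0"
  have gcd: "g c \<le> g d" using g \<open>c \<le> d\<close> by (auto simp: mono_on_def)
  \<comment> \<open>Chosen so that the weak type estimate yields measure at most \<open>e\<close>;
    the summand 1 keeps \<open>q\<close> positive when \<open>g\<close> is constant.\<close>
  define q where "q = (g d - g c + 1) / e"
  have "q > 0" using gcd \<open>e > 0\<close> by (auto simp: q_def)
  obtain T where T: "T \<in> lmeasurable" "S \<subseteq> T" "q * measure lebesgue T \<le> g d - g c"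
    using mono_on_steep_set_bound[OF g \<open>c \<le> d\<close> \<open>0 < q\<close> S] steep \<open>0 < q\<close> by metis
  have "q * measure lebesgue T \<le> q * e"
    using T(3) \<open>e > 0\<close> by (simp add: q_def)
  then show "\<exists>T. S \<subseteq> T \<and> T \<in> lmeasurable \<and> measure lebesgue T \<le> e"
    using T \<open>q > 0\<close> by auto
qed

text \<open>Let s be the outer measure of \<open>S\<close>. Shallow intervals inside an open set of
  measure at most s + e cover almost all of \<open>S\<close>. Within each of them \<open>g\<close>
  grows by at most p times the length, so the steep points there have outer measure at most p/q
  times the length. Hence q s \<le> p (s + e) for every e, which forces s = 0.\<close>

lemma mono_on_oscillating_slopes_negligible:
  fixes g :: "real \<Rightarrow> real"
  assumes g: "mono_on {c..d} g" and S: "S \<subseteq> {c<..<d}" and pq: "0 < p" "p < q"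
    and shallow: "\<And>x e. x \<in> S \<Longrightarrow> 0 < e \<Longrightarrow> \<exists>y. y \<noteq> x \<and> \<bar>y - x\<bar> < e \<and> \<bar>g y - g x\<bar> \<le> p * \<bar>y - x\<bar>"
    and steep: "\<And>x e. x \<in> S \<Longrightarrow> 0 < e \<Longrightarrow> \<exists>y. y \<noteq> x \<and> \<bar>y - x\<bar> < e \<and> q * \<bar>y - x\<bar> \<le> \<bar>g y - g x\<bar>"
  shows "negligible S"
proof -
  have gm: "g x \<le> g y" if "c \<le> x" "x \<le> y" "y \<le> d" for x y
    using g that by (auto simp: mono_on_def)
  \<comment> \<open>The infimum of \<open>M\<close> is the outer measure of \<open>S\<close>, a real
    number since \<open>S\<close> lies in a bounded interval.\<close>
  define M where "M = {measure lebesgue T |T. T \<in> lmeasurable \<and> S \<subseteq> T}"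
  define s where "s = Inf M"
  have "measure lebesgue {c<..<d} \<in> M" unfolding M_def by (intro CollectI exI[of _ "{c<..<d}"]) (use S in auto)
  then have ne: "M \<noteq> {}" by blast
  have bdd: "bdd_below M" by (rule bdd_belowI[of _ 0]) (auto simp: M_def)
  have s_le: "s \<le> measure lebesgue T" if "T \<in> lmeasurable" "S \<subseteq> T" for T
    unfolding s_def using that by (intro cInf_lower bdd) (auto simp: M_def)
  have near: "\<exists>T \<in> lmeasurable. S \<subseteq> T \<and> measure lebesgue T < s + e" if "e > 0" for e
  proof -
    have "\<exists>m\<in>M. m < s + e"
      using ne bdd that unfolding s_def by (intro cInf_lessD) auto
    then show ?thesis by (auto simp: M_def)
  qed
  have key: "q * s \<le> p * (s + e)" if e: "e > 0" for e
  proof -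
    obtain T0 where T0: "T0 \<in> lmeasurable" "S \<subseteq> T0" "measure lebesgue T0 < s + e/2"
      using near[of "e/2"] e by auto
    obtain U0 where U0: "open U0" "T0 \<subseteq> U0" "U0 - T0 \<in> lmeasurable"
        and "emeasure lebesgue (U0 - T0) < ennreal (e/2)"
      using sets_lebesgue_outer_open[of T0 "e/2"] T0 e by (metis half_gt_zero fmeasurableD)
    then have U0': "measure lebesgue (U0 - T0) < e/2"
      using e by (simp add: emeasure_eq_measure2 ennreal_less_iff)
    \<comment> \<open>The intersection keeps the covering intervals where \<open>g\<close> is
      monotone, as the weak type estimate on each of them requires.\<close>
    define U where "U = U0 \<inter> {c<..<d}"
    have U: "open U" "S \<subseteq> U" using U0 T0 S by (auto simp: U_def)
    have Um: "U \<in> lmeasurable" "measure lebesgue U \<le> s + e"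
    proof -
      have UU: "T0 \<union> (U0 - T0) \<in> lmeasurable" using T0 U0 by (intro fmeasurable.Un)
      show "U \<in> lmeasurable" unfolding U_def using U0(1) by (intro lmeasurable_open) (auto simp: bounded_Int)
      have "measure lebesgue U \<le> measure lebesgue (T0 \<union> (U0 - T0))"
        by (rule measure_mono_fmeasurable[OF _ _ UU]) (use U in \<open>auto simp: U_def\<close>)
      also have "\<dots> \<le> measure lebesgue T0 + measure lebesgue (U0 - T0)"
        by (rule measure_Un_le) (use T0 U0 in auto)
      finally show "measure lebesgue U \<le> s + e" using T0 U0' by linarith
    qed
    let ?R = "\<lambda>u w. g w - g u \<le> p * (w - u)"
    obtain C where C: "countable C" "nonoverlapping C"
      "\<And>I. I \<in> C \<Longrightarrow> {fst I..snd I} \<subseteq> U \<and> ?R (fst I) (snd I)"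
      "negligible (S - (\<Union>I\<in>C. {fst I..snd I}))"
    proof (rule Vitali_covering_intervals[of U S ?R])
      fix x and e :: real assume x: "x \<in> S" "0 < e"
      define e' where "e' = min e (min (x - c) (d - x))"
      have "e' > 0" using x S by (auto simp: e'_def)
      then obtain y where y: "y \<noteq> x" "\<bar>y - x\<bar> < e'" "\<bar>g y - g x\<bar> \<le> p * \<bar>y - x\<bar>"
        using shallow x by blast
      show "\<exists>u w. u < w \<and> u \<le> x \<and> x \<le> w \<and> w - u < e \<and> ?R u w"
      proof (cases "x < y")
        case True
        then show ?thesis using y by (intro exI[of _ x] exI[of _ y]) (auto simp: e'_def)
      next
        case False
        then show ?thesis using y by (intro exI[of _ y] exI[of _ x]) (auto simp: e'_def)
      qed
    qed (use U in auto)
    have lt: "fst I < snd I" if "I \<in> C" for I using C(2) that by (auto simp: nonoverlapping_def)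
    have "\<exists>T. T \<in> lmeasurable \<and> S \<inter> {fst I<..<snd I} \<subseteq> T \<and> measure lebesgue T \<le> p / q * (snd I - fst I)"
      if I: "I \<in> C" for I
    proof -
      have "{fst I..snd I} \<subseteq> {c..d}" using C(3)[OF I] by (auto simp: U_def)
      then have "mono_on {fst I..snd I} g" using g mono_on_subset by blast
      then obtain T where "T \<in> lmeasurable" "S \<inter> {fst I<..<snd I} \<subseteq> T"
          "q * measure lebesgue T \<le> g (snd I) - g (fst I)"
      proof (rule mono_on_steep_set_bound[of "fst I" "snd I" g q "S \<inter> {fst I<..<snd I}"])
        show "\<exists>y. y \<noteq> x \<and> \<bar>y - x\<bar> < e \<and> q * \<bar>y - x\<bar> \<le> \<bar>g y - g x\<bar>"
          if "x \<in> S \<inter> {fst I<..<snd I}" "0 < e" for x e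
          using steep that by blast
      qed (use lt[OF I] pq in auto)
      moreover have "g (snd I) - g (fst I) \<le> p * (snd I - fst I)" using C(3)[OF I] by blast
      ultimately show ?thesis using pq by (intro exI[of _ T]) (auto simp: field_simps)
    qed
    then obtain T where T: "\<And>I. I \<in> C \<Longrightarrow> T I \<in> lmeasurable"
        "\<And>I. I \<in> C \<Longrightarrow> S \<inter> {fst I<..<snd I} \<subseteq> T I"
        "\<And>I. I \<in> C \<Longrightarrow> measure lebesgue (T I) \<le> p / q * (snd I - fst I)"
      by metis
    have "(\<Sum>I\<in>D. measure lebesgue (T I)) \<le> p / q * (s + e)" if "D \<subseteq> C" "finite D" for D
    proof -
      have "(\<Sum>I\<in>D. measure lebesgue (T I)) \<le> (\<Sum>I\<in>D. p / q * (snd I - fst I))"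
        by (rule sum_mono) (use T that in blast)
      also have "\<dots> = p / q * (\<Sum>I\<in>D. snd I - fst I)" by (simp add: sum_distrib_left)
      also have "(\<Sum>I\<in>D. snd I - fst I) \<le> measure lebesgue U"
        using that C(3) nonoverlapping_subset[OF C(2)] Um
        by (intro nonoverlapping_sum_length_le) auto
      finally show ?thesis using pq Um by (meson divide_pos_pos less_trans less_imp_le mult_left_mono order_trans)
    qed
    note V = UN_lmeasurable_sum_bound[OF C(1) T(1) this]
    \<comment> \<open>Points missed by the covering, together with all endpoints: the weak type
      estimate was applied to open intervals only.\<close>
    let ?N = "(S - (\<Union>I\<in>C. {fst I..snd I})) \<union> (\<Union>I\<in>C. {fst I, snd I})"
    have "negligible (\<Union>I\<in>C. {fst I, snd I})"
      using C(1) by (intro negligible_countable_Union) auto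
    then have N: "negligible ?N" using C(4) by (intro negligible_Un)
    then have N': "?N \<in> lmeasurable" "measure lebesgue ?N = 0"
      by (auto simp only: negligible_imp_measurable negligible_imp_measure0)
    have cov: "S \<subseteq> (\<Union>I\<in>C. T I) \<union> ?N"
    proof
      fix x assume x: "x \<in> S"
      show "x \<in> (\<Union>I\<in>C. T I) \<union> ?N"
      proof (cases "\<exists>I\<in>C. x \<in> {fst I..snd I}")
        case True
        then obtain I where I: "I \<in> C" "x \<in> {fst I..snd I}" by blast
        then consider "x \<in> {fst I<..<snd I}" | "x \<in> {fst I, snd I}" by fastforce
        then show ?thesis using I T(2)[OF I(1)] x by cases blast+
      qed (use x in blast)
    qed
    have "s \<le> measure lebesgue ((\<Union>I\<in>C. T I) \<union> ?N)"
      by (rule s_le[OF _ cov]) (intro fmeasurable.Un V(1) N'(1))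
    also have "\<dots> \<le> measure lebesgue (\<Union>I\<in>C. T I) + measure lebesgue ?N"
      by (rule measure_Un_le) (use V(1) N'(1) in \<open>blast intro: fmeasurableD\<close>)+
    also have "\<dots> \<le> p / q * (s + e)" using V(2) N'(2) by simp
    finally show ?thesis using pq by (simp add: field_simps)
  qed
  have "q * s \<le> p * s"
  proof (rule field_le_epsilon)
    fix e :: real assume "e > 0"
    then have "0 < e / p" using pq by simp
    from key[OF this] show "q * s \<le> p * s + e" using pq by (simp add: distrib_left)
  qed
  then have "(q - p) * s \<le> 0" by (simp add: algebra_simps)
  then have "s \<le> 0"
    using pq by (simp add: mult_le_0_iff)
  show "negligible S"
    unfolding negligible_outer
  proof (intro allI impI)
    fix e :: real assume "e > 0"
    from near[OF this] obtain T where "T \<in> lmeasurable" "S \<subseteq> T" "measure lebesgue T < s + e" by blast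
    with \<open>s \<le> 0\<close> show "\<exists>T. S \<subseteq> T \<and> T \<in> lmeasurable \<and> measure lebesgue T < e"
      by (intro exI[of _ T]) auto
  qed
qed

text \<open>Compare the lower and the upper limit of the slope. If they differ, two rationals p < q
  fit strictly between them, p being positive because slopes are nonnegative, and x lies in one of
  countably many sets \<open>Spq p q\<close>. If they agree but are infinite, x lies in
  \<open>Sinf\<close>. Otherwise the slope converges.\<close>

lemma mono_on_abs_slope_converges_ae:
  fixes g :: "real \<Rightarrow> real"
  assumes g: "mono_on {c..d} g"
  shows "negligible {x \<in> {c<..<d}. \<nexists>l. ((\<lambda>y. \<bar>g y - g x\<bar> / \<bar>y - x\<bar>) \<longlongrightarrow> l) (at x)}"
proof (cases "c \<le> d")
  case True
  let ?s = "\<lambda>x y. \<bar>g y - g x\<bar> / \<bar>y - x\<bar>"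
  define Sinf where "Sinf = {x \<in> {c<..<d}. \<forall>q>0. \<exists>\<^sub>F y in at x. q \<le> ?s x y}"
  define Spq where "Spq = (\<lambda>p q. {x \<in> {c<..<d}. (\<exists>\<^sub>F y in at x. ?s x y \<le> p) \<and> (\<exists>\<^sub>F y in at x. q \<le> ?s x y)})"
  have freq: "(\<exists>\<^sub>F y in at x. P (?s x y)) \<longleftrightarrow> (\<forall>e>0. \<exists>y. y \<noteq> x \<and> \<bar>y - x\<bar> < e \<and> P (?s x y))" for P x
    by (auto simp: frequently_at dist_real_def)
  have s_iff: "(q \<le> ?s x y \<longleftrightarrow> q * \<bar>y - x\<bar> \<le> \<bar>g y - g x\<bar>)" "(?s x y \<le> q \<longleftrightarrow> \<bar>g y - g x\<bar> \<le> q * \<bar>y - x\<bar>)"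
    if "y \<noteq> x" for q x y
    using that by (simp_all add: field_simps)
  have "negligible Sinf"
  proof (rule mono_on_infinitely_steep_negligible[OF g True])
    fix x e q :: real assume "x \<in> Sinf" "0 < e" "0 < q"
    then show "\<exists>y. y \<noteq> x \<and> \<bar>y - x\<bar> < e \<and> q * \<bar>y - x\<bar> \<le> \<bar>g y - g x\<bar>"
      unfolding Sinf_def freq[of "\<lambda>t. q \<le> t" for q] using s_iff(1) by blast
  qed (auto simp: Sinf_def)
  moreover have "negligible (Spq p q)" if "0 < p" "p < q" for p q
  proof (rule mono_on_oscillating_slopes_negligible[OF g _ that])
    fix x e :: real assume x: "x \<in> Spq p q" "0 < e"
    then show "\<exists>y. y \<noteq> x \<and> \<bar>y - x\<bar> < e \<and> q * \<bar>y - x\<bar> \<le> \<bar>g y - g x\<bar>"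
      unfolding Spq_def freq[of "\<lambda>t. q \<le> t" for q] using s_iff(1) by blast
    show "\<exists>y. y \<noteq> x \<and> \<bar>y - x\<bar> < e \<and> \<bar>g y - g x\<bar> \<le> p * \<bar>y - x\<bar>"
      using x unfolding Spq_def freq[of "\<lambda>t. t \<le> q" for q] using s_iff(2) by blast
  qed (auto simp: Spq_def)
  then have "negligible (\<Union>(p, q) \<in> {(p, q). 0 < p \<and> p < q \<and> p \<in> \<rat> \<and> q \<in> \<rat>}. Spq p q)"
  proof (intro negligible_countable_Union)
    have "{(p::real, q::real). 0 < p \<and> p < q \<and> p \<in> \<rat> \<and> q \<in> \<rat>} \<subseteq> \<rat> \<times> \<rat>" by auto
    then have "countable {(p::real, q::real). 0 < p \<and> p < q \<and> p \<in> \<rat> \<and> q \<in> \<rat>}"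
      by (rule countable_subset) (intro countable_SIGMA countable_rat)
    then show "countable ((\<lambda>(p, q). Spq p q) ` {(p, q). 0 < p \<and> p < q \<and> p \<in> \<rat> \<and> q \<in> \<rat>})"
      by (rule countable_image)
  qed auto
  ultimately have "negligible (Sinf \<union> (\<Union>(p, q) \<in> {(p, q). 0 < p \<and> p < q \<and> p \<in> \<rat> \<and> q \<in> \<rat>}. Spq p q))"
    by (rule negligible_Un)
  then show ?thesis
  proof (rule negligible_subset, intro subsetI)
    fix x assume x: "x \<in> {x \<in> {c<..<d}. \<nexists>l. (?s x \<longlongrightarrow> l) (at x)}"
    define li where "li = Liminf (at x) (\<lambda>y. ereal (?s x y))"
    define ls where "ls = Limsup (at x) (\<lambda>y. ereal (?s x y))"
    have li0: "0 \<le> li" unfolding li_def by (rule Liminf_bounded) auto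
    have lils: "li \<le> ls" unfolding li_def ls_def by (rule Liminf_le_Limsup) simp
    have gtq: "\<exists>\<^sub>F y in at x. q \<le> ?s x y" if "ereal q < ls" for q
    proof (rule ccontr)
      assume "\<not> (\<exists>\<^sub>F y in at x. q \<le> ?s x y)"
      then have "\<forall>\<^sub>F y in at x. ereal (?s x y) \<le> ereal q"
        unfolding not_frequently by eventually_elim auto
      then have "ls \<le> ereal q" unfolding ls_def by (rule Limsup_bounded)
      with that show False by auto
    qed
    have ltp: "\<exists>\<^sub>F y in at x. ?s x y \<le> q" if "li < ereal q" for q
    proof (rule ccontr)
      assume "\<not> (\<exists>\<^sub>F y in at x. ?s x y \<le> q)"
      then have "\<forall>\<^sub>F y in at x. ereal q \<le> ereal (?s x y)"
        unfolding not_frequently by eventually_elim auto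
      then have "ereal q \<le> li" unfolding li_def by (rule Liminf_bounded)
      with that show False by auto
    qed
    show "x \<in> Sinf \<union> (\<Union>(p, q) \<in> {(p, q). 0 < p \<and> p < q \<and> p \<in> \<rat> \<and> q \<in> \<rat>}. Spq p q)"
    proof (cases "li < ls")
      case True
      then obtain p where p: "li < ereal (real_of_rat p)" "ereal (real_of_rat p) < ls"
        using ereal_dense3 by blast
      then obtain q where q: "ereal (real_of_rat p) < ereal (real_of_rat q)" "ereal (real_of_rat q) < ls"
        using ereal_dense3 by blast
      have p0: "0 < real_of_rat p" using p li0 by (metis ereal_less(2) le_less_trans)
      have "x \<in> Spq (real_of_rat p) (real_of_rat q)"
        unfolding Spq_def using x ltp[OF p(1)] gtq[OF q(2)] by auto
      then show ?thesis using p0 q by auto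
    next
      case False
      then have eq: "li = ls" using lils by simp
      show ?thesis
      proof (cases "ls = \<infinity>")
        case True
        then show ?thesis using x gtq by (auto simp: Sinf_def)
      next
        case False
        then obtain r where r: "ls = ereal r" using li0 eq by (cases ls) auto
        have "((\<lambda>y. ereal (?s x y)) \<longlongrightarrow> ereal r) (at x)"
          by (rule Liminf_eq_Limsup) (use r eq in \<open>auto simp: li_def ls_def\<close>)
        then show ?thesis using x by auto
      qed
    qed
  qed
qed auto

section \<open>The metric derivative is the derivative of the variation\<close>

definition partition :: "real \<Rightarrow> real \<Rightarrow> nat \<Rightarrow> (nat \<Rightarrow> real) \<Rightarrow> bool" where
  "partition a x n p \<longleftrightarrow> p 0 = a \<and> p n = x \<and> (\<forall>i<n. p i < p (Suc i))"

lemma variation_eq: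
  "variation f a x = (SUP np \<in> {np. partition a x (fst np) (snd np)}.
     ennreal (\<Sum>i<fst np. dist (f (snd np (Suc i))) (f (snd np i))))"
  unfolding variation_def partition_def by (rule arg_cong[where f=Sup]) auto

lemma partition_exists: "a \<le> x \<Longrightarrow> \<exists>n p. partition a x n p"
proof (cases "a = x")
  case True
  then show ?thesis unfolding partition_def by (intro exI[of _ 0] exI[of _ "\<lambda>_. a"]) simp
next
  case False
  assume "a \<le> x"
  with False show ?thesis unfolding partition_def
    by (intro exI[of _ 1] exI[of _ "\<lambda>i. if i = 0 then a else x"]) simp
qed

lemma partition_mono:
  assumes "partition a x n p" "i \<le> j" "j \<le> n"
  shows "p i \<le> p j"
  using assms(2,3)
proof (induction j rule: dec_induct)
  case (step m)
  then have "p m < p (Suc m)" using assms(1) by (auto simp: partition_def)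
  with step show ?case by simp
qed simp

lemma partition_cell_exists:
  assumes "partition a x n p" "a < x" "y \<in> {a..x}"
  obtains i where "i < n" "y \<in> {p i..p (Suc i)}"
proof -
  \<comment> \<open>Restricting to \<open>i < n\<close> assigns the right end \<open>x\<close> to
    the last cell.\<close>
  define i where "i = Max {i. i < n \<and> p i \<le> y}"
  have p: "p 0 = a" "p n = x" using assms(1) by (auto simp: partition_def)
  have "n \<noteq> 0"
  proof
    assume "n = 0"
    with p assms(2) show False by simp
  qed
  then have ne: "{i. i < n \<and> p i \<le> y} \<noteq> {}" using assms p by (auto intro!: exI[of _ 0])
  have i: "i < n" "p i \<le> y"
    using Max_in[OF _ ne] by (auto simp: i_def)
  have "y \<le> p (Suc i)"
  proof (cases "Suc i < n")
    case True
    have "\<not> p (Suc i) \<le> y"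
    proof
      assume "p (Suc i) \<le> y"
      then have "Suc i \<le> i" unfolding i_def using True i_def by (intro Max_ge) auto
      then show False by simp
    qed
    then show ?thesis by simp
  next
    case False
    then have "Suc i = n" using i by simp
    then show ?thesis using assms p by simp
  qed
  with i show thesis by (intro that) auto
qed

text \<open>Appending \<open>y\<close> to a partition ending at \<open>x\<close> adds exactly the
  last distance. Partitions are strictly increasing, so \<open>x = y\<close> is separate. Working in
  \<open>ennreal\<close> makes this valid also for infinite variation.\<close>

lemma variation_add_dist_le:
  assumes "a \<le> x" "x \<le> y"
  shows "variation f a x + ennreal (dist (f x) (f y)) \<le> variation f a y"
proof (cases "x = y")
  case False
  let ?P = "\<lambda>x. {np. partition a x (fst np) (snd np)}"
  let ?s = "\<lambda>np. (\<Sum>i<fst np. dist (f (snd np (Suc i))) (f (snd np i)))"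
  have ne: "?P x \<noteq> {}" using partition_exists[OF assms(1)] by auto
  have "variation f a x + ennreal (dist (f x) (f y)) = (SUP np \<in> ?P x. ennreal (?s np) + ennreal (dist (f x) (f y)))"
    unfolding variation_eq by (rule ennreal_SUP_add_left[OF ne, symmetric])
  also have "\<dots> \<le> variation f a y"
  proof (rule SUP_least)
    fix np assume np: "np \<in> ?P x"
    obtain n p where [simp]: "np = (n, p)" by (cases np)
    define p' where "p' = p(Suc n := y)"
    have p: "p 0 = a" "p n = x" "\<And>i. i < n \<Longrightarrow> p i < p (Suc i)"
      using np by (auto simp: partition_def)
    have "(Suc n, p') \<in> ?P y"
      using p False assms by (auto simp: partition_def p'_def less_Suc_eq)
    then have "ennreal (?s (Suc n, p')) \<le> variation f a y"
      unfolding variation_eq by (rule SUP_upper)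
    moreover have "(\<Sum>i<n. dist (f (p' (Suc i))) (f (p' i))) = ?s np"
      by (auto simp: p'_def intro!: sum.cong)
    then have "?s (Suc n, p') = ?s np + dist (f x) (f y)"
      by (simp add: p'_def p dist_commute)
    moreover have "ennreal (?s np + dist (f x) (f y)) = ennreal (?s np) + ennreal (dist (f x) (f y))"
      by (intro ennreal_plus sum_nonneg) auto
    ultimately show "ennreal (?s np) + ennreal (dist (f x) (f y)) \<le> variation f a y"
      by (simp only:)
  qed
  finally show ?thesis .
qed simp

lemma variation_mono: "a \<le> x \<Longrightarrow> x \<le> y \<Longrightarrow> variation f a x \<le> variation f a y"
  by (rule order_trans[OF _ variation_add_dist_le]) auto

context
  fixes f :: "real \<Rightarrow> 'a::metric_space" and a b :: real
  assumes BV: "bounded_variation f a b"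
begin

lemma var_fun_add_dist_le:
  assumes "a \<le> x" "x \<le> y" "y \<le> b"
  shows "var_fun f a x + dist (f x) (f y) \<le> var_fun f a y"
proof -
  have fin: "variation f a y < top" "variation f a x < top"
    using BV variation_mono[of a y b f] variation_mono[of a x b f] assms
    unfolding bounded_variation_def infinity_ennreal_def by (auto intro: le_less_trans)
  have "ennreal (var_fun f a x + dist (f x) (f y)) = variation f a x + ennreal (dist (f x) (f y))"
    using fin by (simp add: var_fun_def ennreal_plus)
  also have "\<dots> \<le> variation f a y" by (rule variation_add_dist_le) (use assms in auto)
  also have "\<dots> = ennreal (var_fun f a y)" using fin by (simp add: var_fun_def)
  finally show ?thesis
    by (subst (asm) ennreal_le_iff) (simp_all add: var_fun_def)
qed

lemma mono_on_var_fun: "mono_on {a..b} (var_fun f a)"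
proof (rule mono_onI)
  fix x y assume "x \<in> {a..b}" "y \<in> {a..b}" "x \<le> y"
  then have "var_fun f a x + dist (f x) (f y) \<le> var_fun f a y"
    by (intro var_fun_add_dist_le) auto
  then show "var_fun f a x \<le> var_fun f a y"
    using zero_le_dist[of "f x" "f y"] by linarith
qed

lemma dist_le_abs_var_fun:
  assumes "x \<in> {a..b}" "y \<in> {a..b}"
  shows "dist (f y) (f x) \<le> \<bar>var_fun f a y - var_fun f a x\<bar>"
proof (cases "x \<le> y")
  case True
  then show ?thesis using var_fun_add_dist_le[of x y] assms by (simp add: dist_commute)
next
  case False
  then show ?thesis using var_fun_add_dist_le[of y x] assms by simp
qed

text \<open>By the triangle inequality the distance to \<open>z\<close> rises by at most
  \<open>dist (f x) (f y)\<close>, which the increment of the variation absorbs. Later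
  \<open>z\<close> is the value of \<open>f\<close> at the left end of a cell, so that the
  subtracted term vanishes there.\<close>

lemma mono_on_var_fun_minus_dist: "mono_on {a..b} (\<lambda>x. var_fun f a x - dist (f x) z)"
proof (rule mono_onI)
  fix x y assume "x \<in> {a..b}" "y \<in> {a..b}" "x \<le> y"
  then have "var_fun f a x + dist (f x) (f y) \<le> var_fun f a y"
    by (intro var_fun_add_dist_le) auto
  moreover have "dist (f y) z \<le> dist (f x) (f y) + dist (f x) z"
    using dist_triangle[of "f y" z "f x"] by (simp add: dist_commute)
  ultimately show "var_fun f a x - dist (f x) z \<le> var_fun f a y - dist (f y) z" by linarith
qed

text \<open>The increments of the variation telescope, so the sum is the gap between the total
  variation and a partition sum, and the supremum is approached by partition sums.\<close>

lemma variation_almost_attained: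
  assumes "a \<le> b" "0 < e"
  obtains n p where "partition a b n p"
    "(\<Sum>i<n. var_fun f a (p (Suc i)) - var_fun f a (p i) - dist (f (p (Suc i))) (f (p i))) < e"
proof -
  let ?P = "{np. partition a b (fst np) (snd np)}"
  let ?s = "\<lambda>np. (\<Sum>i<fst np. dist (f (snd np (Suc i))) (f (snd np i)))"
  have fin: "variation f a b < top" using BV by (simp add: bounded_variation_def infinity_ennreal_def)
  have "\<exists>np \<in> ?P. var_fun f a b < ?s np + e"
  proof (rule ccontr)
    assume c: "\<not> ?thesis"
    have ne: "?P \<noteq> {}" using partition_exists[OF assms(1)] by auto
    have le: "?s np \<le> var_fun f a b - e" if "np \<in> ?P" for np using c that by force
    \<comment> \<open>\<open>ennreal\<close> sends negative reals to 0, so the comparison can be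
      read back in the reals only once the bound is known to be nonnegative.\<close>
    have nn: "0 \<le> var_fun f a b - e"
    proof -
      obtain np where "np \<in> ?P" using ne by blast
      moreover have "0 \<le> ?s np" by (intro sum_nonneg) auto
      ultimately show ?thesis using le[of np] by linarith
    qed
    have "variation f a b \<le> ennreal (var_fun f a b - e)"
      unfolding variation_eq by (rule SUP_least) (intro ennreal_leI le)
    then have "ennreal (var_fun f a b) \<le> ennreal (var_fun f a b - e)"
      using fin by (simp add: var_fun_def)
    then show False using nn assms(2) by (simp add: ennreal_le_iff)
  qed
  then obtain n p where np: "partition a b n p"
      "var_fun f a b < (\<Sum>i<n. dist (f (p (Suc i))) (f (p i))) + e"
    by auto
  have "(\<Sum>i<n. var_fun f a (p (Suc i)) - var_fun f a (p i) - dist (f (p (Suc i))) (f (p i)))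
      = (var_fun f a (p n) - var_fun f a (p 0)) - (\<Sum>i<n. dist (f (p (Suc i))) (f (p i)))"
    using sum_lessThan_telescope[of "\<lambda>i. var_fun f a (p i)" n] by (simp add: sum_subtractf)
  moreover have "0 \<le> var_fun f a (p 0)" by (simp add: var_fun_def)
  moreover have "p n = b" using np(1) by (simp add: partition_def)
  ultimately have "(\<Sum>i<n. var_fun f a (p (Suc i)) - var_fun f a (p i) - dist (f (p (Suc i))) (f (p i))) < e"
    using np(2) by simp
  with np(1) show thesis by (rule that)
qed

text \<open>On a cell with left end \<^term>\<open>p i\<close> the function \<^term>\<open>\<lambda>x. var_fun f a x - dist (f x) (f (p i))\<close> is
  monotone, and its increments over all cells add up to the defect of the partition sum. So the
  weak type estimate applies with an arbitrarily small total increment.\<close>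

lemma var_fun_exceeds_dist_negligible:
  assumes "a < b" "0 < q"
  shows "negligible {x \<in> {a<..<b}. \<exists>\<^sub>F y in at x.
           q * \<bar>y - x\<bar> \<le> \<bar>var_fun f a y - var_fun f a x\<bar> - dist (f y) (f x)}" (is "negligible ?B")
  unfolding negligible_outer_le
proof (intro allI impI)
  let ?v = "var_fun f a"
  fix e :: real assume e: "e > 0"
  then have "q * e > 0" using assms by simp
  then obtain n p where p: "partition a b n p"
    "(\<Sum>i<n. ?v (p (Suc i)) - ?v (p i) - dist (f (p (Suc i))) (f (p i))) < q * e"
    using variation_almost_attained[of "q * e"] assms by auto
  let ?k = "\<lambda>i x. ?v x - dist (f x) (f (p i))"
  have cell: "a \<le> p i" "p i < p (Suc i)" "p (Suc i) \<le> b" if "i < n" for i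
    using p(1) partition_mono[OF p(1), of 0 i] partition_mono[OF p(1), of "Suc i" n] that
    by (auto simp: partition_def)
  define ok where "ok = (\<lambda>i T. T \<in> lmeasurable \<and> ?B \<inter> {p i<..<p (Suc i)} \<subseteq> T \<and>
       q * measure lebesgue T \<le> ?k i (p (Suc i)) - ?k i (p i))"
  have "\<exists>T. ok i T" if i: "i < n" for i
  proof -
    note c = cell[OF i]
    have "mono_on {p i..p (Suc i)} (?k i)"
      by (rule mono_on_subset[OF mono_on_var_fun_minus_dist]) (use c in auto)
    then obtain T where "T \<in> lmeasurable" "?B \<inter> {p i<..<p (Suc i)} \<subseteq> T"
       "q * measure lebesgue T \<le> ?k i (p (Suc i)) - ?k i (p i)"
    proof (rule mono_on_steep_set_bound[OF _ _ \<open>0 < q\<close>, of _ _ _ "?B \<inter> {p i<..<p (Suc i)}"])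
      fix x and e :: real assume x: "x \<in> ?B \<inter> {p i<..<p (Suc i)}" "0 < e"
      then have "\<exists>y. y \<noteq> x \<and> dist y x < e \<and> q * \<bar>y - x\<bar> \<le> \<bar>?v y - ?v x\<bar> - dist (f y) (f x)"
        by (auto simp: frequently_at)
      then obtain y where y: "y \<noteq> x" "\<bar>y - x\<bar> < e" "q * \<bar>y - x\<bar> \<le> \<bar>?v y - ?v x\<bar> - dist (f y) (f x)"
        by (auto simp: dist_real_def)
      \<comment> \<open>Reverse triangle inequality: replacing the variation by \<open>?k i\<close>
        costs at most \<open>dist (f y) (f x)\<close> in the increment, precisely the amount by
        which the increment of the variation is in excess.\<close>
      have "\<bar>dist (f y) (f (p i)) - dist (f x) (f (p i))\<bar> \<le> dist (f y) (f x)"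
        using dist_triangle[of "f y" "f (p i)" "f x"] dist_triangle[of "f x" "f (p i)" "f y"]
        by (simp add: dist_commute abs_le_iff)
      then have "q * \<bar>y - x\<bar> \<le> \<bar>?k i y - ?k i x\<bar>" using y(3) by linarith
      then show "\<exists>y. y \<noteq> x \<and> \<bar>y - x\<bar> < e \<and> q * \<bar>y - x\<bar> \<le> \<bar>?k i y - ?k i x\<bar>"
        using y by blast
    qed (use c in auto)
    then show ?thesis unfolding ok_def by blast
  qed
  then have "\<forall>i. \<exists>T. i < n \<longrightarrow> ok i T" by blast
  from choice[OF this] obtain T where "\<And>i. i < n \<Longrightarrow> ok i (T i)" by blast
  then have T: "\<And>i. i < n \<Longrightarrow> T i \<in> lmeasurable"
      "\<And>i. i < n \<Longrightarrow> ?B \<inter> {p i<..<p (Suc i)} \<subseteq> T i"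
      "\<And>i. i < n \<Longrightarrow> q * measure lebesgue (T i) \<le> ?k i (p (Suc i)) - ?k i (p i)"
    by (auto simp only: ok_def)
  \<comment> \<open>The partition points are added because each \<open>T i\<close> only covers
    points in an open cell.\<close>
  let ?W = "(\<Union>i\<in>{..<n}. T i) \<union> p ` {..n}"
  have U: "(\<Union>i\<in>{..<n}. T i) \<in> lmeasurable" using T(1) by (intro fmeasurable.finite_UN) auto
  have neg: "negligible (p ` {..n})" by (rule negligible_finite) simp
  note fin = negligible_imp_measurable[OF neg] negligible_imp_measure0[OF neg]
  have "measure lebesgue ?W \<le> measure lebesgue (\<Union>i\<in>{..<n}. T i) + measure lebesgue (p ` {..n})"
    by (rule measure_Un_le[OF fmeasurableD[OF U] fmeasurableD[OF fin(1)]])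
  also have "\<dots> = measure lebesgue (\<Union>i\<in>{..<n}. T i)" unfolding fin(2) by (rule add_0_right)
  also have "\<dots> \<le> (\<Sum>i<n. measure lebesgue (T i))"
    by (rule measure_UNION_le[OF finite_lessThan]) (rule fmeasurableD[OF T(1)], rule lessThan_iff[THEN iffD1])
  finally have "q * measure lebesgue ?W \<le> q * (\<Sum>i<n. measure lebesgue (T i))"
    using less_imp_le[OF assms(2)] by (rule mult_left_mono)
  also have "\<dots> \<le> (\<Sum>i<n. ?k i (p (Suc i)) - ?k i (p i))"
    unfolding sum_distrib_left by (rule sum_mono) (use T(3) in auto)
  also have "\<dots> = (\<Sum>i<n. ?v (p (Suc i)) - ?v (p i) - dist (f (p (Suc i))) (f (p i)))"
    by (rule sum.cong) auto
  finally have "q * measure lebesgue ?W \<le> q * e" using p(2) by linarith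
  then have "measure lebesgue ?W \<le> e" using assms by simp
  moreover have "?B \<subseteq> ?W"
  proof
    fix x assume x: "x \<in> ?B"
    then have "x \<in> {a..b}" by auto
    then obtain i where i: "i < n" "x \<in> {p i..p (Suc i)}"
      using partition_cell_exists[OF p(1) assms(1)] by blast
    then consider "x = p i" | "x = p (Suc i)" | "x \<in> {p i<..<p (Suc i)}" by fastforce
    then show "x \<in> ?W"
    proof cases
      case 3
      then show ?thesis using T(2)[OF i(1)] x i(1) by blast
    qed (use i(1) in auto)
  qed
  moreover have "?W \<in> lmeasurable" using U fin(1) by (rule fmeasurable.Un)
  ultimately show "\<exists>T. ?B \<subseteq> T \<and> T \<in> lmeasurable \<and> measure lebesgue T \<le> e" by blast
qed

text \<open>The difference of the two quotients is nonnegative, since the variation dominates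
  distances. Outside the null sets \<open>B (1 / Suc m)\<close> it is eventually below every
  1/(m+1), so it tends to 0 and both quotients share the limit of the slope of the
  variation.\<close>

lemma metric_derivative_eq_var_fun_slope_ae:
  assumes "a < b"
  shows "negligible {x \<in> {a<..<b}. \<nexists>l.
    ((\<lambda>y. \<bar>var_fun f a y - var_fun f a x\<bar> / \<bar>y - x\<bar>) \<longlongrightarrow> l) (at x) \<and>
    ((\<lambda>y. dist (f y) (f x) / \<bar>y - x\<bar>) \<longlongrightarrow> l) (at x)}" (is "negligible ?N")
proof -
  let ?v = "var_fun f a"
  define B where "B = (\<lambda>q. {x \<in> {a<..<b}. \<exists>\<^sub>F y in at x. q * \<bar>y - x\<bar> \<le> \<bar>?v y - ?v x\<bar> - dist (f y) (f x)})"
  define D where "D = {x \<in> {a<..<b}. \<nexists>l. ((\<lambda>y. \<bar>?v y - ?v x\<bar> / \<bar>y - x\<bar>) \<longlongrightarrow> l) (at x)}"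
  have "negligible D"
    unfolding D_def by (rule mono_on_abs_slope_converges_ae[OF mono_on_var_fun])
  moreover have "negligible (\<Union>m::nat. B (1 / Suc m))"
    unfolding B_def by (intro negligible_Union_nat var_fun_exceeds_dist_negligible assms) auto
  ultimately have "negligible (D \<union> (\<Union>m::nat. B (1 / Suc m)))" by (rule negligible_Un)
  then show ?thesis
  proof (rule negligible_subset, intro subsetI)
    fix x assume x: "x \<in> ?N"
    show "x \<in> D \<union> (\<Union>m::nat. B (1 / Suc m))"
    proof (rule ccontr)
      assume nDB: "x \<notin> D \<union> (\<Union>m::nat. B (1 / Suc m))"
      have xab: "x \<in> {a<..<b}" using CollectD[OF x] by (rule conjunct1)
      have "x \<notin> D" and nB: "x \<notin> B (1 / Suc m)" for m :: nat using nDB by blast+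
      then have "\<exists>l. ((\<lambda>y. \<bar>?v y - ?v x\<bar> / \<bar>y - x\<bar>) \<longlongrightarrow> l) (at x)"
        using xab unfolding D_def mem_Collect_eq by argo
      then obtain l where l: "((\<lambda>y. \<bar>?v y - ?v x\<bar> / \<bar>y - x\<bar>) \<longlongrightarrow> l) (at x)" ..
      let ?h = "\<lambda>y. \<bar>?v y - ?v x\<bar> / \<bar>y - x\<bar> - dist (f y) (f x) / \<bar>y - x\<bar>"
      have nb: "\<forall>\<^sub>F y in at x. y \<in> {a<..<b}"
        by (rule eventually_at_in_open') (use xab in auto)
      have "(?h \<longlongrightarrow> 0) (at x)"
      proof (rule tendstoI)
        fix e :: real assume "e > 0"
        then obtain m :: nat where m: "1 / Suc m < e"
          using nat_approx_posE by blast
        have "\<forall>\<^sub>F y in at x. \<not> (1 / Suc m * \<bar>y - x\<bar> \<le> \<bar>?v y - ?v x\<bar> - dist (f y) (f x))"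
          using nB[of m] xab by (auto simp: B_def not_frequently)
        moreover have "\<forall>\<^sub>F y in at x. y \<noteq> x" by (simp add: eventually_at_filter)
        ultimately show "\<forall>\<^sub>F y in at x. dist (?h y) 0 < e" using nb
        proof eventually_elim
          case (elim y)
          then have "0 \<le> \<bar>?v y - ?v x\<bar> - dist (f y) (f x)"
            using dist_le_abs_var_fun[of x y] xab by auto
          then have "\<bar>?h y\<bar> = (\<bar>?v y - ?v x\<bar> - dist (f y) (f x)) / \<bar>y - x\<bar>"
            unfolding diff_divide_distrib[symmetric] by simp
          also have "\<dots> < 1 / Suc m" using elim by (simp add: divide_less_eq mult.commute)
          finally show ?case using m by simp
        qed
      qed
      from tendsto_diff[OF l this] have "((\<lambda>y. dist (f y) (f x) / \<bar>y - x\<bar>) \<longlongrightarrow> l) (at x)"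
        by simp
      with l have "\<exists>l. ((\<lambda>y. \<bar>?v y - ?v x\<bar> / \<bar>y - x\<bar>) \<longlongrightarrow> l) (at x) \<and>
          ((\<lambda>y. dist (f y) (f x) / \<bar>y - x\<bar>) \<longlongrightarrow> l) (at x)" by (intro exI conjI)
      with CollectD[OF x] show False by (elim conjE notE)
    qed
  qed
qed

end

section \<open>Null sets and flat sets under the variation\<close>

text \<open>The definition speaks of indexed families; coverings produce sets of intervals, which an
  enumeration turns into such a family.\<close>

lemma absolutely_continuous_on_interval_finite_set:
  assumes "absolutely_continuous_on_interval f a b" "0 < r"
  obtains \<delta> where "0 < \<delta>"
    "\<And>D. finite D \<Longrightarrow> nonoverlapping D \<Longrightarrow> (\<And>I. I \<in> D \<Longrightarrow> {fst I..snd I} \<subseteq> {a..b}) \<Longrightarrow>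
       (\<Sum>I\<in>D. snd I - fst I) < \<delta> \<Longrightarrow> (\<Sum>I\<in>D. dist (f (snd I)) (f (fst I))) < r"
proof -
  from assms(1)[unfolded absolutely_continuous_on_interval_def, THEN spec, THEN mp, OF assms(2)]
  obtain \<delta> where \<delta>: "0 < \<delta>" "\<forall>(n::nat) (u::nat \<Rightarrow> real) (v::nat \<Rightarrow> real).
        (\<forall>i<n. a \<le> u i \<and> u i \<le> v i \<and> v i \<le> b) \<longrightarrow>
        (\<forall>i<n. \<forall>j<n. i \<noteq> j \<longrightarrow> v i \<le> u j \<or> v j \<le> u i) \<longrightarrow>
        (\<Sum>i<n. v i - u i) < \<delta> \<longrightarrow> (\<Sum>i<n. dist (f (v i)) (f (u i))) < r"
    by (elim exE conjE) (rule that)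
  show thesis
  proof (rule that[OF \<delta>(1)])
    fix D :: "(real \<times> real) set"
    assume D: "finite D" "nonoverlapping D" "\<And>I. I \<in> D \<Longrightarrow> {fst I..snd I} \<subseteq> {a..b}"
      and len: "(\<Sum>I\<in>D. snd I - fst I) < \<delta>"
    from D(1) obtain h where h: "bij_betw h {..<card D} D"
      using ex_bij_betw_nat_finite by (metis atLeast0LessThan)
    then have hD: "h i \<in> D" if "i < card D" for i using that by (auto simp: bij_betw_def)
    have hne: "h i \<noteq> h j" if "i < card D" "j < card D" "i \<noteq> j" for i j
      using h that by (auto simp: bij_betw_def inj_on_def)
    have "(\<Sum>i<card D. dist (f (snd (h i))) (f (fst (h i)))) < r"
    proof (rule \<delta>(2)[THEN spec[where x = "card D"], THEN spec[where x = "\<lambda>i. fst (h i)"],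
          THEN spec[where x = "\<lambda>i. snd (h i)"], THEN mp, THEN mp, THEN mp])
      show "\<forall>i<card D. a \<le> fst (h i) \<and> fst (h i) \<le> snd (h i) \<and> snd (h i) \<le> b"
      proof (intro allI impI)
        fix i assume "i < card D"
        then have "h i \<in> D" by (rule hD)
        moreover from this have "fst (h i) < snd (h i)" using D(2) by (auto simp: nonoverlapping_def)
        ultimately show "a \<le> fst (h i) \<and> fst (h i) \<le> snd (h i) \<and> snd (h i) \<le> b"
          using D(3)[of "h i"] by auto
      qed
      show "\<forall>i<card D. \<forall>j<card D. i \<noteq> j \<longrightarrow> snd (h i) \<le> fst (h j) \<or> snd (h j) \<le> fst (h i)"
        using D(2) hD hne unfolding nonoverlapping_def pairwise_def by blast
      show "(\<Sum>i<card D. snd (h i) - fst (h i)) < \<delta>"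
        using len sum.reindex_bij_betw[OF h, of "\<lambda>I. snd I - fst I"] by simp
    qed
    then show "(\<Sum>I\<in>D. dist (f (snd I)) (f (fst I))) < r"
      using sum.reindex_bij_betw[OF h, of "\<lambda>I. dist (f (snd I)) (f (fst I))"] by simp
  qed
qed

text \<open>Here every point must be covered: a Vitali covering leaves out a null set, which is no
  help when \<open>S\<close> itself is null. The price is that the intervals may touch.\<close>

lemma nonoverlapping_cover_within_open:
  fixes c d :: real
  assumes "c < d" "open U" "S \<subseteq> U" "S \<subseteq> {c..d}"
  obtains C where "countable C" "nonoverlapping C" "\<And>I. I \<in> C \<Longrightarrow> {fst I..snd I} \<subseteq> U \<inter> {c..d}"
    "S \<subseteq> (\<Union>I\<in>C. {fst I..snd I})"
proof -
  \<comment> \<open>A gauge must give a neighbourhood of every point, hence \<open>UNIV\<close> off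
    \<open>U\<close>. Each interval of the covering lies in \<open>G x\<close> for some x in
    \<open>S\<close>, and there \<open>G x\<close> is \<open>U\<close>.\<close>
  define G where "G = (\<lambda>x. if x \<in> U then U else UNIV)"
  have gauge: "gauge G" using assms(2) by (auto simp: gauge_def G_def)
  obtain \<D> where \<D>: "countable \<D>"  "\<Union>\<D> \<subseteq> cbox c d"
    "\<And>K. K \<in> \<D> \<Longrightarrow> interior K \<noteq> {} \<and> (\<exists>c d. K = cbox c d)"
    "pairwise (\<lambda>A B. interior A \<inter> interior B = {}) \<D>"
    "\<And>K. K \<in> \<D> \<Longrightarrow> \<exists>x \<in> S \<inter> K. K \<subseteq> G x"
    "S \<subseteq> \<Union>\<D>"
  proof (rule covering_lemma[of S c d G])
    show "S \<subseteq> cbox c d" "box c d \<noteq> {}" using assms by auto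
  qed (rule gauge, rule that, assumption+)
  define C where "C = {I. fst I < snd I \<and> {fst I..snd I} \<in> \<D>}"
  let ?int = "\<lambda>I::real \<times> real. {fst I..snd I}"
  have "inj_on ?int C" by (auto simp: inj_on_def C_def Icc_eq_Icc)
  moreover have "countable (?int ` C)"
    by (rule countable_subset[OF _ \<D>(1)]) (auto simp: C_def)
  ultimately have "countable C" using countable_image_inj_on by blast
  moreover have "nonoverlapping C"
    unfolding nonoverlapping_def
  proof (intro conjI ballI pairwiseI)
    show "fst I < snd I" if "I \<in> C" for I using that by (simp add: C_def)
    fix I J assume IJ: "I \<in> C" "J \<in> C" "I \<noteq> J"
    then have lt: "fst I < snd I" "fst J < snd J" and D: "?int I \<in> \<D>" "?int J \<in> \<D>" by (auto simp: C_def)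
    have "?int I \<noteq> ?int J" using \<open>inj_on ?int C\<close> IJ by (auto simp: inj_on_def)
    then have "{fst I<..<snd I} \<inter> {fst J<..<snd J} = {}"
      using pairwiseD[OF \<D>(4) D] by (simp add: interior_atLeastAtMost_real)
    moreover have "(max (fst I) (fst J) + min (snd I) (snd J)) / 2 \<in> {fst I<..<snd I} \<inter> {fst J<..<snd J}"
      if "fst J < snd I" "fst I < snd J"
      using lt that by (auto simp: max_def min_def)
    ultimately have "\<not> (fst J < snd I \<and> fst I < snd J)" by blast
    then show "snd I \<le> fst J \<or> snd J \<le> fst I" by linarith
  qed
  moreover have "?int I \<subseteq> U \<inter> {c..d}" if "I \<in> C" for I
  proof -
    have I: "?int I \<in> \<D>" using that by (simp add: C_def)
    with \<D>(5) obtain x where "x \<in> S" "?int I \<subseteq> G x" by blast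
    then have "?int I \<subseteq> U" using assms(3) \<open>x \<in> S\<close> by (auto simp: G_def subset_eq)
    moreover have "?int I \<subseteq> {c..d}" using Union_upper[OF I] \<D>(2) unfolding cbox_interval by (rule subset_trans)
    ultimately show ?thesis by blast
  qed
  moreover have "S \<subseteq> (\<Union>I\<in>C. ?int I)"
  proof
    fix x assume "x \<in> S"
    then obtain K where K: "K \<in> \<D>" "x \<in> K" using \<D>(6) by blast
    then obtain u w where uw: "K = cbox u w" "interior K \<noteq> {}" using \<D>(3) by blast
    then have "u < w" by (auto simp: interior_atLeastAtMost_real)
    then have "(u, w) \<in> C" using K uw by (simp add: C_def)
    then show "x \<in> (\<Union>I\<in>C. ?int I)" using K uw by (intro UN_I) auto
  qed
  ultimately show thesis by (rule that)
qed

lemma negligible_open_superset: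
  assumes "negligible N" "0 < e"
  obtains U where "open U" "N \<subseteq> U" "U \<in> lmeasurable" "measure lebesgue U < e"
proof -
  have N: "N \<in> sets lebesgue" "emeasure lebesgue N = 0"
    using assms(1) negligible_imp_sets negligible_iff_emeasure0 by auto
  obtain U where U: "open U" "N \<subseteq> U" "U - N \<in> lmeasurable" "emeasure lebesgue (U - N) < ennreal e"
    using sets_lebesgue_outer_open[OF N(1) assms(2)] by blast
  have eq: "U = N \<union> (U - N)" using U(2) by blast
  have Nm: "N \<in> lmeasurable" "measure lebesgue N = 0"
    by (rule negligible_imp_measurable[OF assms(1)], rule negligible_imp_measure0[OF assms(1)])
  have "U \<in> lmeasurable"
    by (subst eq) (rule fmeasurable.Un[OF Nm(1) U(3)])
  have "measure lebesgue U \<le> measure lebesgue N + measure lebesgue (U - N)"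
    by (subst eq) (rule measure_Un_le[OF N(1) fmeasurableD[OF U(3)]])
  moreover have "measure lebesgue (U - N) < e"
    using U(3,4) assms(2) by (simp add: emeasure_eq_measure2 ennreal_less_iff)
  ultimately have "measure lebesgue U < e" using Nm(2) by linarith
  with U(1,2) \<open>U \<in> lmeasurable\<close> show thesis by (rule that)
qed

context
  fixes f :: "real \<Rightarrow> 'a::metric_space" and a b :: real
  assumes BV: "bounded_variation f a b" and AC: "absolutely_continuous_on_interval f a b"
begin

text \<open>Over each covering interval the increment of the variation is at most the increment of
  \<open>?k\<close> plus the distance of the end values of \<open>f\<close>. The first kind adds up
  to at most the defect of the cell, since \<open>?k\<close> is monotone; the second adds up to less
  than \<open>r\<close> by absolute continuity, since the intervals lie in an open set of small
  measure.\<close>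

lemma var_fun_null_image_in_cell:
  assumes "a \<le> c" "c < d" "d \<le> b" "0 < r" "negligible N"
  obtains T where "T \<in> lmeasurable" "var_fun f a ` (N \<inter> {c..d}) \<subseteq> T"
    "measure lebesgue T \<le> var_fun f a d - var_fun f a c - dist (f d) (f c) + r"
proof -
  let ?v = "var_fun f a"
  let ?k = "\<lambda>x. ?v x - dist (f x) (f c)"
  have vm: "?v x \<le> ?v y" if "c \<le> x" "x \<le> y" "y \<le> d" for x y
    using mono_on_var_fun[OF BV] that assms by (auto simp: mono_on_def)
  have km: "mono_on {c..d} ?k"
    by (rule mono_on_subset[OF mono_on_var_fun_minus_dist[OF BV]]) (use assms in auto)
  obtain \<delta> where \<delta>: "0 < \<delta>"
    "\<And>D. finite D \<Longrightarrow> nonoverlapping D \<Longrightarrow> (\<And>I. I \<in> D \<Longrightarrow> {fst I..snd I} \<subseteq> {a..b}) \<Longrightarrow>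
       (\<Sum>I\<in>D. snd I - fst I) < \<delta> \<Longrightarrow> (\<Sum>I\<in>D. dist (f (snd I)) (f (fst I))) < r"
    using absolutely_continuous_on_interval_finite_set[OF AC \<open>0 < r\<close>] by blast
  obtain U where U: "open U" "N \<subseteq> U" "U \<in> lmeasurable" "measure lebesgue U < \<delta>"
    using negligible_open_superset[OF assms(5) \<delta>(1)] by blast
  have NU: "N \<inter> {c..d} \<subseteq> U" using U(2) by blast
  obtain C where C: "countable C" "nonoverlapping C" "\<And>I. I \<in> C \<Longrightarrow> {fst I..snd I} \<subseteq> U \<inter> {c..d}"
    "N \<inter> {c..d} \<subseteq> (\<Union>I\<in>C. {fst I..snd I})"
    using nonoverlapping_cover_within_open[OF assms(2) U(1) NU Int_lower2] by blast
  have I: "c \<le> fst I \<and> fst I < snd I \<and> snd I \<le> d" if "I \<in> C" for I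
  proof -
    have "fst I < snd I" using C(2) that by (auto simp: nonoverlapping_def)
    then show ?thesis using C(3)[OF that] by auto
  qed
  have bound: "(\<Sum>I\<in>D. measure lebesgue {?v (fst I)..?v (snd I)}) \<le> ?k d - ?k c + r"
    if D: "D \<subseteq> C" "finite D" for D
  proof -
    have nD: "nonoverlapping D" using C(2) D(1) by (rule nonoverlapping_subset)
    have DI: "c \<le> fst I \<and> fst I < snd I \<and> snd I \<le> d" "{fst I..snd I} \<subseteq> U" if "I \<in> D" for I
      using that D(1) I C(3) by blast+
    have "(\<Sum>I\<in>D. measure lebesgue {?v (fst I)..?v (snd I)}) = (\<Sum>I\<in>D. ?v (snd I) - ?v (fst I))"
    proof (rule sum.cong)
      fix I assume "I \<in> D"
      from DI(1)[OF this] have "?v (fst I) \<le> ?v (snd I)" by (intro vm) auto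
      then show "measure lebesgue {?v (fst I)..?v (snd I)} = ?v (snd I) - ?v (fst I)" by simp
    qed simp
    also have "\<dots> \<le> (\<Sum>I\<in>D. (?k (snd I) - ?k (fst I)) + dist (f (snd I)) (f (fst I)))"
    proof (rule sum_mono)
      fix I
      show "?v (snd I) - ?v (fst I) \<le> (?k (snd I) - ?k (fst I)) + dist (f (snd I)) (f (fst I))"
        using dist_triangle[of "f (snd I)" "f c" "f (fst I)"] by linarith
    qed
    also have "\<dots> = (\<Sum>I\<in>D. ?k (snd I) - ?k (fst I)) + (\<Sum>I\<in>D. dist (f (snd I)) (f (fst I)))"
      by (rule sum.distrib)
    also have "(\<Sum>I\<in>D. ?k (snd I) - ?k (fst I)) \<le> ?k d - ?k c"
      by (rule nonoverlapping_sum_increments_le[OF D(2) nD _ km]) (use DI assms in auto)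
    also have "(\<Sum>I\<in>D. snd I - fst I) < \<delta>"
      using nonoverlapping_sum_length_le[OF D(2) nD DI(2) U(3)] U(4) by linarith
    then have "(\<Sum>I\<in>D. dist (f (snd I)) (f (fst I))) < r"
    proof (intro \<delta>(2)[OF D(2) nD])
      show "{fst I..snd I} \<subseteq> {a..b}" if "I \<in> D" for I using DI(1)[OF that] assms by auto
    qed
    finally show ?thesis by simp
  qed
  note T = UN_lmeasurable_sum_bound[where T = "\<lambda>I. {?v (fst I)..?v (snd I)}", OF C(1) lmeasurable_interval(1) bound]
  have "?v ` (N \<inter> {c..d}) \<subseteq> (\<Union>I\<in>C. {?v (fst I)..?v (snd I)})"
  proof (rule image_subsetI)
    fix x assume "x \<in> N \<inter> {c..d}"
    then obtain I' where I': "I' \<in> C" "x \<in> {fst I'..snd I'}" using C(4) by blast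
    from I[OF this(1)] I'(2) have "?v x \<in> {?v (fst I')..?v (snd I')}" by (auto intro!: vm)
    with I'(1) show "?v x \<in> (\<Union>I\<in>C. {?v (fst I)..?v (snd I)})" by (rule UN_I)
  qed
  moreover have "measure lebesgue (\<Union>I\<in>C. {?v (fst I)..?v (snd I)}) \<le> ?v d - ?v c - dist (f d) (f c) + r"
    using T(2) by simp
  ultimately show thesis using that T(1) by blast
qed

text \<open>For a nearly optimal partition the defects of the cells sum to less than e/2, and the
  errors \<open>r\<close> of the n cells to at most e/2. The partition is fixed before
  \<open>r\<close>, which may therefore depend on its size.\<close>

lemma var_fun_null_image:
  assumes "negligible N" "a < b" "N \<subseteq> {a..b}"
  shows "negligible (var_fun f a ` N)"
  unfolding negligible_outer_le
proof (intro allI impI)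
  let ?v = "var_fun f a"
  fix e :: real assume "e > 0"
  then have "e / 2 > 0" by simp
  then obtain n p where p: "partition a b n p"
    "(\<Sum>i<n. ?v (p (Suc i)) - ?v (p i) - dist (f (p (Suc i))) (f (p i))) < e / 2"
    using variation_almost_attained[OF BV, of "e / 2"] assms(2) by auto
  \<comment> \<open>The summand 1 makes \<open>r\<close> positive whatever \<open>n\<close>
    is.\<close>
  define r where "r = e / 2 / (real n + 1)"
  have r: "r > 0" "real n * r \<le> e / 2" using \<open>e > 0\<close> by (auto simp: r_def field_simps)
  have cell: "a \<le> p i" "p i < p (Suc i)" "p (Suc i) \<le> b" if "i < n" for i
    using p(1) partition_mono[OF p(1), of 0 i] partition_mono[OF p(1), of "Suc i" n] that
    by (auto simp: partition_def)
  define ok where "ok = (\<lambda>i T. T \<in> lmeasurable \<and> ?v ` (N \<inter> {p i..p (Suc i)}) \<subseteq> T \<and>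
     measure lebesgue T \<le> ?v (p (Suc i)) - ?v (p i) - dist (f (p (Suc i))) (f (p i)) + r)"
  have "\<exists>T. ok i T" if "i < n" for i
  proof (rule var_fun_null_image_in_cell[OF cell[OF that] r(1) assms(1)])
    show "\<exists>T. ok i T" if "T \<in> lmeasurable" "?v ` (N \<inter> {p i..p (Suc i)}) \<subseteq> T"
      "measure lebesgue T \<le> ?v (p (Suc i)) - ?v (p i) - dist (f (p (Suc i))) (f (p i)) + r" for T
      unfolding ok_def by (rule exI[of _ T]) (intro conjI that)
  qed
  then have "\<forall>i. \<exists>T. i < n \<longrightarrow> ok i T" by blast
  from choice[OF this] obtain T where "\<And>i. i < n \<Longrightarrow> ok i (T i)" by blast
  then have T: "\<And>i. i < n \<Longrightarrow> T i \<in> lmeasurable"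
      "\<And>i. i < n \<Longrightarrow> ?v ` (N \<inter> {p i..p (Suc i)}) \<subseteq> T i"
      "\<And>i. i < n \<Longrightarrow> measure lebesgue (T i) \<le> ?v (p (Suc i)) - ?v (p i) - dist (f (p (Suc i))) (f (p i)) + r"
    by (auto simp only: ok_def)
  have "measure lebesgue (\<Union>i\<in>{..<n}. T i) \<le> (\<Sum>i<n. measure lebesgue (T i))"
    by (rule measure_UNION_le[OF finite_lessThan]) (rule fmeasurableD[OF T(1)], rule lessThan_iff[THEN iffD1])
  also have "\<dots> \<le> (\<Sum>i<n. ?v (p (Suc i)) - ?v (p i) - dist (f (p (Suc i))) (f (p i)) + r)"
    by (rule sum_mono) (rule T(3), rule lessThan_iff[THEN iffD1])
  also have "\<dots> = (\<Sum>i<n. ?v (p (Suc i)) - ?v (p i) - dist (f (p (Suc i))) (f (p i))) + real n * r"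
    by (simp add: sum.distrib)
  finally have "measure lebesgue (\<Union>i\<in>{..<n}. T i) \<le> e" using p(2) r(2) by linarith
  moreover have "(\<Union>i\<in>{..<n}. T i) \<in> lmeasurable" using T(1) by (intro fmeasurable.finite_UN) auto
  moreover have "?v ` N \<subseteq> (\<Union>i\<in>{..<n}. T i)"
  proof (rule image_subsetI)
    fix x assume x: "x \<in> N"
    then have "x \<in> {a..b}" using assms(3) by blast
    then obtain i where i: "i < n" "x \<in> {p i..p (Suc i)}"
      using partition_cell_exists[OF p(1) assms(2)] by blast
    then have "?v x \<in> T i" using T(2)[OF i(1)] x by blast
    then show "?v x \<in> (\<Union>i\<in>{..<n}. T i)" using i(1) by blast
  qed
  ultimately show "\<exists>T. ?v ` N \<subseteq> T \<and> T \<in> lmeasurable \<and> measure lebesgue T \<le> e" by blast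
qed

end

text \<open>Intervals of slope at most \<open>q\<close> cover \<open>S\<close> up to a null set, and
  their images have total length at most q (b - a). The uncovered remainder may have a large image
  in general; \<open>null_image\<close> is what controls it.\<close>

lemma flat_set_image_negligible:
  fixes g :: "real \<Rightarrow> real"
  assumes g: "mono_on {a..b} g" and "a \<le> b" and S: "S \<subseteq> {a<..<b}"
    and flat: "\<And>x. x \<in> S \<Longrightarrow> ((\<lambda>y. \<bar>g y - g x\<bar> / \<bar>y - x\<bar>) \<longlongrightarrow> 0) (at x)"
    and null_image: "\<And>N. negligible N \<Longrightarrow> N \<subseteq> {a..b} \<Longrightarrow> negligible (g ` N)"
  shows "negligible (g ` S)"
  unfolding negligible_outer_le
proof (intro allI impI)
  fix r :: real assume "r > 0"
  \<comment> \<open>The summand 1 avoids a zero denominator for a degenerate interval.\<close>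
  define q where "q = r / (b - a + 1)"
  have q: "q > 0" "q * (b - a) \<le> r" using \<open>r > 0\<close> \<open>a \<le> b\<close> by (auto simp: q_def field_simps)
  have gm: "g x \<le> g y" if "a \<le> x" "x \<le> y" "y \<le> b" for x y
    using g that by (auto simp: mono_on_def)
  let ?R = "\<lambda>u w. g w - g u \<le> q * (w - u)"
  obtain C where C: "countable C" "nonoverlapping C"
    "\<And>I. I \<in> C \<Longrightarrow> {fst I..snd I} \<subseteq> {a<..<b} \<and> ?R (fst I) (snd I)"
    "negligible (S - (\<Union>I\<in>C. {fst I..snd I}))"
  proof (rule Vitali_covering_intervals[of "{a<..<b}" S ?R])
    fix x and e :: real assume x: "x \<in> S" "0 < e"
    have "\<forall>\<^sub>F y in at x. \<bar>g y - g x\<bar> / \<bar>y - x\<bar> < q"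
      using order_tendstoD(2)[OF flat[OF x(1)] q(1)] .
    then obtain s where s: "s > 0" "\<And>y. y \<noteq> x \<Longrightarrow> dist y x < s \<Longrightarrow> \<bar>g y - g x\<bar> / \<bar>y - x\<bar> < q"
      unfolding eventually_at by blast
    \<comment> \<open>Any nearby point would do; half of the smaller radius keeps \<open>w\<close>
      strictly within both.\<close>
    define w where "w = x + min s e / 2"
    have w: "x < w" "w - x < e" "dist w x < s"
      using s(1) x(2) by (auto simp: w_def dist_real_def)
    have "g w - g x \<le> q * (w - x)"
      using s(2)[of w] w by (simp add: divide_less_eq)
    then show "\<exists>u w. u < w \<and> u \<le> x \<and> x \<le> w \<and> w - u < e \<and> ?R u w"
      using w by (intro exI[of _ x] exI[of _ w]) auto
  qed (use S in auto)
  have I: "a \<le> fst I \<and> fst I < snd I \<and> snd I \<le> b" if "I \<in> C" for I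
  proof -
    have "fst I < snd I" using C(2) that by (auto simp: nonoverlapping_def)
    moreover from this have "fst I \<in> {a<..<b}" "snd I \<in> {a<..<b}" using C(3)[OF that]
      by (simp_all add: subset_eq)
    ultimately show ?thesis by simp
  qed
  have bound: "(\<Sum>I\<in>D. measure lebesgue {g (fst I)..g (snd I)}) \<le> r" if D: "D \<subseteq> C" "finite D" for D
  proof -
    have "(\<Sum>I\<in>D. measure lebesgue {g (fst I)..g (snd I)}) \<le> (\<Sum>I\<in>D. q * (snd I - fst I))"
    proof (rule sum_mono)
      fix J assume "J \<in> D"
      then have "J \<in> C" using D(1) by blast
      have "g (fst J) \<le> g (snd J)" using I[OF \<open>J \<in> C\<close>] by (intro gm) auto
      then show "measure lebesgue {g (fst J)..g (snd J)} \<le> q * (snd J - fst J)"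
        using C(3)[OF \<open>J \<in> C\<close>] by simp
    qed
    also have "\<dots> = q * (\<Sum>I\<in>D. snd I - fst I)" by (simp add: sum_distrib_left)
    also have "\<dots> \<le> q * measure lebesgue {a<..<b}"
    proof (rule mult_left_mono)
      show "(\<Sum>I\<in>D. snd I - fst I) \<le> measure lebesgue {a<..<b}"
        by (rule nonoverlapping_sum_length_le[OF D(2) nonoverlapping_subset[OF C(2) D(1)]])
           (use C(3) D(1) in blast, simp)
    qed (use q in simp)
    also have "\<dots> \<le> r" using q \<open>a \<le> b\<close> by simp
    finally show ?thesis .
  qed
  note T = UN_lmeasurable_sum_bound[where T = "\<lambda>I. {g (fst I)..g (snd I)}", OF C(1) lmeasurable_interval(1) bound]
  let ?V = "\<Union>I\<in>C. {g (fst I)..g (snd I)}" and ?N = "g ` (S - (\<Union>I\<in>C. {fst I..snd I}))"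
  have N: "negligible ?N"
    by (rule null_image[OF C(4)]) (use S in auto)
  note N' = negligible_imp_measurable[OF N] negligible_imp_measure0[OF N]
  have "measure lebesgue (?V \<union> ?N) \<le> measure lebesgue ?V + measure lebesgue ?N"
    by (rule measure_Un_le[OF fmeasurableD[OF T(1)] fmeasurableD[OF N'(1)]])
  also have "\<dots> \<le> r" unfolding N'(2) using T(2) by simp
  finally have "measure lebesgue (?V \<union> ?N) \<le> r" .
  moreover have "g ` S \<subseteq> ?V \<union> ?N"
  proof (rule image_subsetI)
    fix x assume x: "x \<in> S"
    show "g x \<in> ?V \<union> ?N"
    proof (cases "\<exists>J\<in>C. x \<in> {fst J..snd J}")
      case True
      then obtain J where J: "J \<in> C" "x \<in> {fst J..snd J}" by blast
      from I[OF this(1)] J(2) have "g x \<in> {g (fst J)..g (snd J)}" by (auto intro!: gm)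
      with J(1) show ?thesis by blast
    qed (use x in blast)
  qed
  moreover have "?V \<union> ?N \<in> lmeasurable" using T(1) N'(1) by (rule fmeasurable.Un)
  ultimately show "\<exists>T. g ` S \<subseteq> T \<and> T \<in> lmeasurable \<and> measure lebesgue T \<le> r" by blast
qed

section \<open>The image measure as an integral\<close>

text \<open>Change of variables with the integrand 1 on the image. The bound \<open>K\<close> and
  the finite measure of \<open>E\<close> make \<open>h\<close> absolutely integrable, which the
  change of variables formula needs in order to yield a finite image measure.\<close>

lemma lmeasurable_image_bounded_derivative:
  fixes g h :: "real \<Rightarrow> real"
  assumes E: "E \<in> lmeasurable" and h: "h \<in> borel_measurable lebesgue"
    and bounds: "\<And>x. x \<in> E \<Longrightarrow> 0 \<le> h x \<and> h x \<le> K"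
    and der: "\<And>x. x \<in> E \<Longrightarrow> (g has_field_derivative h x) (at x)" and inj: "inj_on g E"
  shows "g ` E \<in> lmeasurable"
    "emeasure lebesgue (g ` E) = (\<integral>\<^sup>+ x. ennreal (h x) * indicator E x \<partial>lebesgue)"
proof -
  have Es: "E \<in> sets lebesgue" using E by (rule fmeasurableD)
  have hE: "h absolutely_integrable_on E"
  proof (rule measurable_bounded_by_integrable_imp_absolutely_integrable[where g = "\<lambda>_. K"])
    show "h \<in> borel_measurable (lebesgue_on E)" using h by (rule measurable_restrict_space1)
    show "(\<lambda>_. K) integrable_on E" using E by (rule integrable_on_const)
    show "norm (h x) \<le> K" if "x \<in> E" for x using bounds[OF that] by simp
  qed (rule Es)
  have absE: "\<bar>h x\<bar> * 1 = h x" if "x \<in> E" for x using bounds[OF that] by simp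
  have "(\<lambda>x. \<bar>h x\<bar> * 1) absolutely_integrable_on E"
    using hE by (rule absolutely_integrable_spike[OF _ negligible_empty]) (use absE in auto)
  moreover have "integral E (\<lambda>x. \<bar>h x\<bar> * 1) = integral E h"
    by (rule integral_cong) (rule absE)
  ultimately have one: "(\<lambda>_. 1::real) absolutely_integrable_on (g ` E)" "integral (g ` E) (\<lambda>_. 1::real) = integral E h"
    using has_absolute_integral_change_of_variables_1'[OF Es has_field_derivative_at_within[OF der] inj,
        of "\<lambda>_. 1" "integral E h"] by auto
  show gE: "g ` E \<in> lmeasurable"
    unfolding lmeasurable_iff_integrable_on using one(1) by (rule set_lebesgue_integral_eq_integral(1))
  have "emeasure lebesgue (g ` E) = ennreal (integral E h)"
    using lmeasure_integral[OF gE] one(2) by (simp add: emeasure_eq_measure2[OF gE])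
  also have "(h has_integral integral E h) E"
    using hE set_lebesgue_integral_eq_integral(1) by (blast intro: integrable_integral)
  then have "ennreal (integral E h) = (\<integral>\<^sup>+ x. ennreal (indicator E x * h x) \<partial>lborel)"
    using bounds by (intro nn_integral_has_integral_lebesgue[symmetric]) auto
  also have "\<dots> = (\<integral>\<^sup>+ x. ennreal (h x) * indicator E x \<partial>lborel)"
    by (rule nn_integral_cong) (simp add: indicator_def)
  also have "\<dots> = (\<integral>\<^sup>+ x. ennreal (h x) * indicator E x \<partial>lebesgue)"
    by (rule nn_integral_completion[symmetric])
  finally show "emeasure lebesgue (g ` E) = (\<integral>\<^sup>+ x. ennreal (h x) * indicator E x \<partial>lebesgue)" .
qed

text \<open>The derivative need not be bounded, so \<open>E\<close> is exhausted by the sets where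
  it is at most k. Reading the integral as the measure of a set under the density \<open>h\<close>,
  both sides converge by continuity of measures from below.\<close>

lemma emeasure_image_eq_nn_integral_derivative:
  fixes g h :: "real \<Rightarrow> real"
  assumes E: "E \<in> lmeasurable" and h: "h \<in> borel_measurable lebesgue"
    and nonneg: "\<And>x. x \<in> E \<Longrightarrow> 0 \<le> h x"
    and der: "\<And>x. x \<in> E \<Longrightarrow> (g has_field_derivative h x) (at x)" and inj: "inj_on g E"
  shows "g ` E \<in> sets lebesgue"
    "emeasure lebesgue (g ` E) = (\<integral>\<^sup>+ x. ennreal (h x) * indicator E x \<partial>lebesgue)"
proof -
  define F where "F = (\<lambda>k::nat. E \<inter> {x. h x \<le> real k})"
  have "{x. h x \<le> real k} \<in> sets lebesgue" for k :: nat
    using borel_measurable_le[OF h borel_measurable_const[of "real k"]] by simp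
  then have F0: "F k \<in> lmeasurable" for k
    unfolding F_def by (rule fmeasurable_Int_fmeasurable[OF E])
  have Fh: "0 \<le> h x \<and> h x \<le> real k" "(g has_field_derivative h x) (at x)" if "x \<in> F k" for x k
    using that nonneg der unfolding F_def by blast+
  have Finj: "inj_on g (F k)" for k by (rule inj_on_subset[OF inj]) (simp add: F_def)
  have F: "g ` F k \<in> lmeasurable" "F k \<in> sets lebesgue"
     "emeasure lebesgue (g ` F k) = (\<integral>\<^sup>+ x. ennreal (h x) * indicator (F k) x \<partial>lebesgue)" for k
    by (rule lmeasurable_image_bounded_derivative[OF F0 h Fh(1) Fh(2) Finj] fmeasurableD[OF F0]; assumption)+
  have incF: "incseq F" by (auto simp: F_def incseq_def)
  have UF: "(\<Union>k. F k) = E" by (auto simp: F_def real_arch_simple)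
  have "g ` E = (\<Union>k. g ` F k)" unfolding UF[symmetric] by (rule image_UN)
  moreover have "(\<Union>k. g ` F k) \<in> sets lebesgue" using fmeasurableD[OF F(1)] by (intro sets.countable_UN) blast
  ultimately show "g ` E \<in> sets lebesgue" by simp
  have "emeasure lebesgue (g ` E) = (SUP k. emeasure lebesgue (g ` F k))"
    unfolding \<open>g ` E = _\<close>
  proof (rule SUP_emeasure_incseq[symmetric])
    show "range (\<lambda>k. g ` F k) \<subseteq> sets lebesgue" using fmeasurableD[OF F(1)] by blast
    show "incseq (\<lambda>k. g ` F k)" using incF unfolding incseq_def by (blast intro: image_mono)
  qed
  also have "\<dots> = (SUP k. emeasure (density lebesgue (\<lambda>x. ennreal (h x))) (F k))"
    unfolding F(3) using h F(2) by (intro SUP_cong refl emeasure_density[symmetric]) auto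
  also have "\<dots> = emeasure (density lebesgue (\<lambda>x. ennreal (h x))) (\<Union>k. F k)"
    by (rule SUP_emeasure_incseq) (use F(2) incF in auto)
  also have "\<dots> = (\<integral>\<^sup>+ x. ennreal (h x) * indicator E x \<partial>lebesgue)"
    unfolding UF using h E by (intro emeasure_density) auto
  finally show "emeasure lebesgue (g ` E) = (\<integral>\<^sup>+ x. ennreal (h x) * indicator E x \<partial>lebesgue)" .
qed

section \<open>Outer measure, and derivatives of monotone functions at single points\<close>

lemma lebesgue_outer_mono: "S \<subseteq> T \<Longrightarrow> lebesgue_outer S \<le> lebesgue_outer T"
  unfolding lebesgue_outer_def by (rule INF_superset_mono) auto

lemma lebesgue_outer_eq_emeasure: "S \<in> sets lebesgue \<Longrightarrow> lebesgue_outer S = emeasure lebesgue S"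
  unfolding lebesgue_outer_def
proof (intro antisym INF_greatest)
  assume S: "S \<in> sets lebesgue"
  then show "(INF T\<in>{T \<in> sets lebesgue. S \<subseteq> T}. emeasure lebesgue T) \<le> emeasure lebesgue S"
    by (intro INF_lower) blast
  show "emeasure lebesgue S \<le> emeasure lebesgue T" if "T \<in> {T \<in> sets lebesgue. S \<subseteq> T}" for T
    by (rule emeasure_mono) (use that in blast)+
qed

text \<open>Difference quotients of a monotone function are nonnegative, so near x the absolute
  values change nothing.\<close>

lemma tendsto_slope_of_abs_slope:
  fixes g :: "real \<Rightarrow> real"
  assumes g: "mono_on {a..b} g" and x: "x \<in> {a<..<b}"
    and l: "((\<lambda>y. \<bar>g y - g x\<bar> / \<bar>y - x\<bar>) \<longlongrightarrow> l) (at x)"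
  shows "(g has_field_derivative l) (at x)"
  unfolding has_field_derivative_iff
proof (rule Lim_transform_eventually[OF l])
  have "\<forall>\<^sub>F y in at x. y \<in> {a<..<b}"
    by (rule eventually_at_in_open') (use x in auto)
  then show "\<forall>\<^sub>F y in at x. \<bar>g y - g x\<bar> / \<bar>y - x\<bar> = (g y - g x) / (y - x)"
  proof eventually_elim
    case (elim y)
    show ?case
    proof (cases "x \<le> y")
      case True
      then have "g x \<le> g y" using g x elim by (auto simp: mono_on_def)
      with True show ?thesis by simp
    next
      case False
      then have "g y \<le> g x" using g x elim by (auto simp: mono_on_def)
      with False have "\<bar>g y - g x\<bar> = - (g y - g x)" "\<bar>y - x\<bar> = - (y - x)" by simp_all
      then show ?thesis by (simp only: minus_divide_divide)
    qed
  qed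
qed

text \<open>Equal values at x < y would make the monotone \<open>g\<close> constant between them, so
  the right derivative at x would be 0.\<close>

lemma inj_on_positive_derivative:
  fixes g :: "real \<Rightarrow> real"
  assumes g: "mono_on {a..b} g" and E: "E \<subseteq> {a<..<b}"
    and der: "\<And>x. x \<in> E \<Longrightarrow> (g has_field_derivative h x) (at x)"
    and pos: "\<And>x. x \<in> E \<Longrightarrow> 0 < h x"
  shows "inj_on g E"
proof (rule linorder_inj_onI')
  fix x y assume xy: "x \<in> E" "y \<in> E" "x < y"
  show "g x \<noteq> g y"
  proof
    assume eq: "g x = g y"
    have "((\<lambda>z. (g z - g x) / (z - x)) \<longlongrightarrow> h x) (at_right x)"
      using der[OF xy(1)] unfolding has_field_derivative_iff by (rule tendsto_within_subset) simp
    moreover have "((\<lambda>z. (g z - g x) / (z - x)) \<longlongrightarrow> 0) (at_right x)"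
    proof (rule Lim_transform_eventually[OF tendsto_const])
      have "\<forall>\<^sub>F z in at_right x. z \<in> {x<..<y}" using xy(3) by (rule eventually_at_right_real)
      then show "\<forall>\<^sub>F z in at_right x. 0 = (g z - g x) / (z - x)"
      proof eventually_elim
        case (elim z)
        have "x \<in> {a..b}" "y \<in> {a..b}" "z \<in> {a..b}" using E xy elim by auto
        then have "g x \<le> g z" "g z \<le> g y" using g elim by (auto simp: mono_on_def)
        then show ?case using eq by simp
      qed
    qed
    ultimately have "h x = 0" by (rule tendsto_unique[OF trivial_limit_at_right_real])
    with pos[OF xy(1)] show False by simp
  qed
qed

text \<open>A measurable function defined everywhere is needed for the integrals. A pointwise limit
  of Borel difference quotients provides it; where they diverge, \<open>lim\<close> gives a value
  about which nothing is claimed.\<close>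

lemma mono_on_borel_derivative:
  fixes g :: "real \<Rightarrow> real"
  assumes g: "mono_on {a..b} g" and "a \<le> b"
  obtains h :: "real \<Rightarrow> real" where "h \<in> borel_measurable borel"
    "\<And>x l. x \<in> {a<..<b} \<Longrightarrow> (g has_field_derivative l) (at x) \<Longrightarrow> h x = l"
proof -
  \<comment> \<open>Clamping the argument to the interval makes the function monotone on the whole
    line, hence Borel.\<close>
  define gc where "gc = (\<lambda>x. g (max a (min b x)))"
  have "mono gc"
    unfolding gc_def mono_def
    using g \<open>a \<le> b\<close> by (auto simp: mono_on_def intro!: max.mono min.mono)
  then have [measurable]: "gc \<in> borel_measurable borel" by (rule borel_measurable_mono)
  define q where "q = (\<lambda>(n::nat) x. (gc (x + inverse (Suc n)) - gc x) / inverse (real (Suc n)))"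
  define h where "h = (\<lambda>x. lim (\<lambda>n. q n x))"
  show thesis
  proof (rule that)
    show "h \<in> borel_measurable borel" unfolding h_def q_def by measurable
    fix x l assume x: "x \<in> {a<..<b}" and l: "(g has_field_derivative l) (at x)"
    have "(\<lambda>n. x + inverse (real (Suc n))) \<longlonglongrightarrow> x + 0"
      by (intro tendsto_intros LIMSEQ_inverse_real_of_nat)
    then have xn: "(\<lambda>n. x + inverse (real (Suc n))) \<longlonglongrightarrow> x" by simp
    then have "filterlim (\<lambda>n. x + inverse (real (Suc n))) (at x) sequentially"
      by (rule filterlim_atI) (auto intro!: always_eventually)
    then have lim: "(\<lambda>n. (g (x + inverse (real (Suc n))) - g x) / (x + inverse (real (Suc n)) - x)) \<longlonglongrightarrow> l"
      using l[unfolded has_field_derivative_iff] by (rule filterlim_compose[rotated])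
    \<comment> \<open>For large n the shifted point is still inside the interval, so the clamping
      has no effect.\<close>
    have "\<forall>\<^sub>F n in sequentially. x + inverse (real (Suc n)) < b"
      by (rule order_tendstoD(2)[OF xn]) (use x in auto)
    then have "\<forall>\<^sub>F n in sequentially.
      (g (x + inverse (real (Suc n))) - g x) / (x + inverse (real (Suc n)) - x) = q n x"
    proof eventually_elim
      case (elim n)
      have "a \<le> x" "x \<le> b" using x by simp_all
      moreover have "x \<le> x + inverse (real (Suc n))" by simp
      with \<open>a \<le> x\<close> have "a \<le> x + inverse (real (Suc n))" by (rule order_trans)
      ultimately have "max a (min b (x + inverse (real (Suc n)))) = x + inverse (real (Suc n))"
        "max a (min b x) = x" using elim by (simp_all only: min_absorb2 max_absorb2 less_imp_le)
      then show ?case unfolding q_def gc_def by simp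
    qed
    with lim have "(\<lambda>n. q n x) \<longlonglongrightarrow> l" by (rule Lim_transform_eventually)
    then show "h x = l" unfolding h_def by (rule limI)
  qed
qed

section \<open>Both halves of the claim, by the sign of the derivative\<close>

theorem theorem3p12:
  fixes f :: "real \<Rightarrow> 'a::metric_space" and a b :: real and A :: "real set"
  assumes "a \<le> b"
    and "bounded_variation f a b"
    and "A \<in> sets lebesgue" and "A \<subseteq> {a..b}"
  shows "lebesgue_outer (var_fun f a ` A)
           \<ge> (\<integral>\<^sup>+ x. ennreal (md f a b x) * indicator A x \<partial>lborel)
         \<and> (absolutely_continuous_on_interval f a b \<longrightarrow>
         lebesgue_outer (var_fun f a ` A)
           = (\<integral>\<^sup>+ x. ennreal (md f a b x) * indicator A x \<partial>lborel))"
proof (cases "a = b")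
  case True
  \<comment> \<open>In a degenerate interval \<open>A\<close> has at most one point, so both sides
    vanish whatever value \<open>md\<close> takes there.\<close>
  then have "finite A" using assms(4) by (auto intro: finite_subset)
  then have "negligible A" "negligible (var_fun f a ` A)"
    by (simp_all add: negligible_finite)
  then have AE: "AE x in lebesgue. x \<notin> A" and "lebesgue_outer (var_fun f a ` A) = 0"
    using lebesgue_outer_eq_emeasure[of "var_fun f a ` A"]
    by (simp_all add: negligible_iff_null_sets AE_not_in null_setsD1 null_setsD2)
  moreover have "(\<integral>\<^sup>+ x. ennreal (md f a b x) * indicator A x \<partial>lebesgue) = (\<integral>\<^sup>+ x. 0 \<partial>(lebesgue :: real measure))"
    by (rule nn_integral_cong_AE) (rule eventually_mono[OF AE], simp)
  ultimately show ?thesis by (simp add: nn_integral_completion)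
next
  case False
  with assms(1) have "a < b" by simp
  let ?v = "var_fun f a"
  note mono = mono_on_var_fun[OF assms(2)]
  define N where "N = {x \<in> {a<..<b}. \<nexists>l.
    ((\<lambda>y. \<bar>?v y - ?v x\<bar> / \<bar>y - x\<bar>) \<longlongrightarrow> l) (at x) \<and>
    ((\<lambda>y. dist (f y) (f x) / \<bar>y - x\<bar>) \<longlongrightarrow> l) (at x)}"
  have N: "negligible N"
    unfolding N_def by (rule metric_derivative_eq_var_fun_slope_ae[OF assms(2) \<open>a < b\<close>])
  obtain h :: "real \<Rightarrow> real" where h: "h \<in> borel_measurable borel"
    "\<And>x l. x \<in> {a<..<b} \<Longrightarrow> (?v has_field_derivative l) (at x) \<Longrightarrow> h x = l"
    using mono_on_borel_derivative[OF mono assms(1)] by blast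
  have hL: "h \<in> borel_measurable lebesgue"
    using h(1) by (intro measurable_completion) simp
  have good: "((\<lambda>y. \<bar>?v y - ?v x\<bar> / \<bar>y - x\<bar>) \<longlongrightarrow> h x) (at x)"
      "(?v has_field_derivative h x) (at x)" "md f a b x = h x" "0 \<le> h x"
    if x: "x \<in> {a<..<b}" "x \<notin> N" for x
  proof -
    have "\<exists>l. ((\<lambda>y. \<bar>?v y - ?v x\<bar> / \<bar>y - x\<bar>) \<longlongrightarrow> l) (at x) \<and>
        ((\<lambda>y. dist (f y) (f x) / \<bar>y - x\<bar>) \<longlongrightarrow> l) (at x)"
      using x unfolding N_def mem_Collect_eq by argo
    then obtain l where l: "((\<lambda>y. \<bar>?v y - ?v x\<bar> / \<bar>y - x\<bar>) \<longlongrightarrow> l) (at x)"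
        "((\<lambda>y. dist (f y) (f x) / \<bar>y - x\<bar>) \<longlongrightarrow> l) (at x)"
      by (elim exE conjE) (rule that)
    have der: "(?v has_field_derivative l) (at x)"
      by (rule tendsto_slope_of_abs_slope[OF mono x(1) l(1)])
    have hl: "h x = l" by (rule h(2)[OF x(1) der])
    show "((\<lambda>y. \<bar>?v y - ?v x\<bar> / \<bar>y - x\<bar>) \<longlongrightarrow> h x) (at x)" unfolding hl by (rule l(1))
    show "(?v has_field_derivative h x) (at x)" unfolding hl by (rule der)
    \<comment> \<open>At interior points the limit defining \<open>md\<close> is two-sided, so it
      can be compared with the slope of the variation.\<close>
    have within: "at x within {a..b} = at x"
      using x(1) by (intro at_within_interior) (simp add: interior_atLeastAtMost_real)
    have "md f a b x = l"
      unfolding md_def within by (rule tendsto_Lim[OF _ l(2)]) simp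
    then show "md f a b x = h x" using hl by simp
    show "0 \<le> h x"
      unfolding hl by (rule tendsto_lowerbound[OF l(1)]) (simp_all add: always_eventually)
  qed
  \<comment> \<open>The endpoints join the exceptional set because differentiability is only
    asserted at interior points.\<close>
  define N' where "N' = N \<union> {a, b}"
  have N': "negligible N'" unfolding N'_def using N by (simp add: negligible_Un)
  then have N'_sets: "N' \<in> sets lebesgue" by (rule negligible_imp_sets)
  have inside: "x \<in> {a<..<b} \<and> x \<notin> N" if "x \<in> A" "x \<notin> N'" for x
    using that assms(4) by (auto simp: N'_def)
  define E1 where "E1 = (A - N') \<inter> {x. 0 < h x}"
  define E0 where "E0 = {x \<in> A - N'. h x = 0}"
  have "A \<in> lmeasurable"
    by (rule fmeasurableI2[OF lmeasurable_interval(1) assms(4,3)])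
  moreover have "{x. 0 < h x} \<in> sets lebesgue"
    using borel_measurable_less[OF borel_measurable_const[of 0] hL] by simp
  ultimately have E1: "E1 \<in> lmeasurable"
    unfolding E1_def using N'_sets
    by (intro fmeasurable_Int_fmeasurable fmeasurable_Diff)
  have E1x: "x \<in> {a<..<b}" "(?v has_field_derivative h x) (at x)" "0 < h x" if "x \<in> E1" for x
    using that inside[of x] good[of x] by (auto simp: E1_def)
  have inj: "inj_on ?v E1"
    by (rule inj_on_positive_derivative[OF mono subsetI]) (use E1x in auto)
  have image: "?v ` E1 \<in> sets lebesgue"
    "emeasure lebesgue (?v ` E1) = (\<integral>\<^sup>+ x. ennreal (h x) * indicator E1 x \<partial>lebesgue)"
    by (rule emeasure_image_eq_nn_integral_derivative[OF E1 hL less_imp_le[OF E1x(3)] E1x(2) inj]; assumption)+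
  have "AE x in lebesgue. x \<notin> N'"
    using N' by (simp add: negligible_iff_null_sets AE_not_in)
  \<comment> \<open>Off \<open>N'\<close> both sides agree: points of \<open>A\<close> outside
    \<open>E1\<close> have \<open>h x = 0\<close>, because \<open>h\<close> is nonnegative
    there.\<close>
  then have "AE x in lebesgue. ennreal (md f a b x) * indicator A x = ennreal (h x) * indicator E1 x"
  proof eventually_elim
    case (elim x)
    show ?case
    proof (cases "x \<in> A")
      case True
      then have "md f a b x = h x" "0 \<le> h x" using inside[OF True elim] good by auto
      with True elim show ?thesis by (auto simp: E1_def indicator_def)
    qed (simp add: E1_def)
  qed
  then have "(\<integral>\<^sup>+ x. ennreal (md f a b x) * indicator A x \<partial>lebesgue)
    = (\<integral>\<^sup>+ x. ennreal (h x) * indicator E1 x \<partial>lebesgue)"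
    by (rule nn_integral_cong_AE)
  \<comment> \<open>The nonnegative integral has the same value for \<open>lborel\<close> and its
    completion for any integrand, so measurability of \<open>md\<close> is not an issue.\<close>
  then have int: "(\<integral>\<^sup>+ x. ennreal (md f a b x) * indicator A x \<partial>lborel) = emeasure lebesgue (?v ` E1)"
    unfolding image(2) by (simp only: nn_integral_completion)
  have lower: "emeasure lebesgue (?v ` E1) \<le> lebesgue_outer (?v ` A)"
    unfolding lebesgue_outer_eq_emeasure[OF image(1), symmetric]
    by (rule lebesgue_outer_mono) (auto simp: E1_def)
  moreover have "lebesgue_outer (?v ` A) \<le> emeasure lebesgue (?v ` E1)"
    if AC: "absolutely_continuous_on_interval f a b"
  proof -
    note null_image = var_fun_null_image[OF assms(2) AC _ \<open>a < b\<close>]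
    have "negligible (?v ` E0)"
    proof (rule flat_set_image_negligible[OF mono assms(1)])
      show "E0 \<subseteq> {a<..<b}" using inside by (auto simp: E0_def)
      show "((\<lambda>y. \<bar>?v y - ?v x\<bar> / \<bar>y - x\<bar>) \<longlongrightarrow> 0) (at x)" if "x \<in> E0" for x
        using that inside[of x] good(1)[of x] by (auto simp: E0_def)
    qed (rule null_image)
    \<comment> \<open>Exceptional points can have an image of positive outer measure for general
      \<open>f\<close>; absolute continuity excludes this, which gives the reverse
      inequality.\<close>
    moreover have "negligible (?v ` (A \<inter> N'))"
      by (rule null_image[OF negligible_subset[OF N' Int_lower2]]) (use assms(4) in auto)
    ultimately have Z: "negligible (?v ` E0 \<union> ?v ` (A \<inter> N'))" (is "negligible ?Z") by (rule negligible_Un)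
    have "?v ` A \<subseteq> ?v ` E1 \<union> ?Z"
    proof (rule image_subsetI)
      fix x assume x: "x \<in> A"
      consider "x \<in> N'" | "x \<notin> N'" "h x = 0" | "x \<notin> N'" "0 < h x"
        using inside[OF x] good(4)[of x] by force
      then show "?v x \<in> ?v ` E1 \<union> ?Z"
        by cases (use x in \<open>auto simp: E1_def E0_def\<close>)
    qed
    then have "lebesgue_outer (?v ` A) \<le> lebesgue_outer (?v ` E1 \<union> ?Z)"
      by (rule lebesgue_outer_mono)
    also have "\<dots> = emeasure lebesgue (?v ` E1 \<union> ?Z)"
      by (rule lebesgue_outer_eq_emeasure[OF sets.Un[OF image(1) negligible_imp_sets[OF Z]]])
    also have "\<dots> = emeasure lebesgue (?v ` E1)"
      by (rule emeasure_Un_null_set[OF image(1) Z[unfolded negligible_iff_null_sets]])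
    finally show ?thesis .
  qed
  ultimately show ?thesis unfolding int by (blast intro: antisym)
qed

end
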